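(* Let $w_t,\varepsilon_t\sim\mathcal N(0,1)$, let $n\ge n_0$, where $n_0$ is an absolute constant, and suppose that inputs are required to be bounded so that $|u_t|\le 64\log^{1/2}n$. For every such $n$, there exist a function class $\mathcal F$ with $|\mathcal F|=2$ and a system (of the form described in the context) with $d_x=d_u=d_y=1$ and $T=1$ such that for any learning algorithm $\mathsf A$ using only $n$ trajectories, and any roll-in policy $\pi$, $$\mathbb E_{\mathsf A}\,\mathbb E_\pi\Big[\big(\hat f_{\mathsf A}(y_1)-f_\star(y_1)\big)^2\Big]\ \ge\ \Omega(1)\cdot\frac{1}{\log^{3/2}n}.$$ Moreover, each $f\in\mathcal F$ is $O(\log^{1/2}n)$-Lipschitz and invertible, with $f'(y)\ge1$ for all $y\in\mathbb R$.
   Context: The system has the form $x_{t+1}=Ax_t+Bu_t+w_t$, $y_t=f_\star^{-1}(x_t)+\varepsilon_t$, started from $x_0$, where $w_t$ is the process noise, $\varepsilon_t$ is an independent output noise, and $f_\star\in\mathcal F$ is the true decoder (without the output noise, $f_\star$ maps $y_t$ to $x_t$); here all quantities are scalar. A learning algorithm $\mathsf A$ accesses the system through $n$ trajectories, on each of which it can play any (possibly adaptively chosen) sequence of control inputs $u_0,\dots,u_T$ and observe $y_0,\dots,y_T$. At the end it outputs a decoder $\hat f_{\mathsf A}$. $\mathbb E_{\mathsf A}$ denotes expectation over the learning process; $\mathbb E_\pi$ denotes expectation over a trajectory of the system whose inputs are chosen by the roll-in policy $\pi$, which is arbitrary and chosen a priori; the performance of the decoder is measured at time $t=1$ under this roll-in.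 $\Omega(1)$ and $O(\cdot)$ hide absolute constants. *)

theory Defs
  imports "HOL-Probability.Probability"
begin

text \<open>
  The scalar system is
    \<open>x (t+1) = A x t + B u t + w t\<close>,  \<open>y t = f\<^sup>-\<^sup>1 (x t) + e t\<close>,
  where the decoder \<open>f\<close> is a bijection.

  A feedback law \<open>g\<close> plays \<open>u t = g t Y\<close>, where \<open>Y\<close> is the observation record \<open>y 0, \<dots>, y t\<close>.
  Records are extensional functions, so a record up to time \<open>t\<close> is a point of
  \<open>Pi\<^sub>M {..t} (\<lambda>_. borel)\<close> and \<open>g t\<close> has access to nothing beyond time \<open>t\<close>. Past inputs are not
  arguments of \<open>g\<close> because they are determined by past observations; randomization enters below
  through a random seed on which the whole law \<open>g\<close> depends.
\<close>

type_synonym obs_seq = "nat \<Rightarrow> real"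

text \<open>\<open>rollout f A B x0 g w e t\<close> is the pair of the state \<open>x t\<close> and the record \<open>y 0, \<dots>, y t\<close>.\<close>

primrec rollout ::
  "(real \<Rightarrow> real) \<Rightarrow> real \<Rightarrow> real \<Rightarrow> real \<Rightarrow> (nat \<Rightarrow> obs_seq \<Rightarrow> real) \<Rightarrow>
   (nat \<Rightarrow> real) \<Rightarrow> (nat \<Rightarrow> real) \<Rightarrow> nat \<Rightarrow> real \<times> obs_seq"
where
  "rollout f A B x0 g w e 0 = (x0, (\<lambda>_. undefined)(0 := inv f x0 + e 0))"
| "rollout f A B x0 g w e (Suc t) =
     (let (x, Y) = rollout f A B x0 g w e t;
          x' = A * x + B * g t Y + w t
      in (x', Y(Suc t := inv f x' + e (Suc t))))"

definition observations ::
  "(real \<Rightarrow> real) \<Rightarrow> real \<Rightarrow> real \<Rightarrow> real \<Rightarrow> (nat \<Rightarrow> obs_seq \<Rightarrow> real) \<Rightarrow>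
   (nat \<Rightarrow> real) \<times> (nat \<Rightarrow> real) \<Rightarrow> nat \<Rightarrow> obs_seq"
where
  "observations f A B x0 g \<omega> t = snd (rollout f A B x0 g (fst \<omega>) (snd \<omega>) t)"

text \<open>
  Law of the pair \<open>(w, e)\<close> of noise sequences of one trajectory: all coordinates are
  independent \<open>N(0,1)\<close> variables.
\<close>

definition noise :: "nat \<Rightarrow> ((nat \<Rightarrow> real) \<times> (nat \<Rightarrow> real)) measure" where
  "noise T =
     Pi\<^sub>M {..T} (\<lambda>_. density lborel (normal_density 0 1)) \<Otimes>\<^sub>M
     Pi\<^sub>M {..T} (\<lambda>_. density lborel (normal_density 0 1))"

text \<open>Measurable space of the records, up to time \<open>T\<close>, of the first \<open>i\<close> trajectories.\<close>

definition data_space :: "nat \<Rightarrow> nat \<Rightarrow> (nat \<Rightarrow> obs_seq) measure" where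
  "data_space T i = Pi\<^sub>M {..<i} (\<lambda>_. Pi\<^sub>M {..T} (\<lambda>_. borel))"

text \<open>
  A randomized roll-in policy with inputs bounded by \<open>b\<close>: a seed \<open>q\<close> is drawn from \<open>Q\<close> and
  \<open>u t = pol q t Y\<close> is played. Every family of conditional input distributions on the reals can
  be realized with a real-valued seed.
\<close>

definition rollin_policy ::
  "nat \<Rightarrow> real \<Rightarrow> real measure \<Rightarrow> (real \<Rightarrow> nat \<Rightarrow> obs_seq \<Rightarrow> real) \<Rightarrow> bool"
where
  "rollin_policy T b Q pol \<longleftrightarrow>
     prob_space Q \<and> sets Q = sets borel \<and>
     (\<forall>t\<le>T. (\<lambda>(q, Y). pol q t Y) \<in> borel_measurable (borel \<Otimes>\<^sub>M Pi\<^sub>M {..t} (\<lambda>_. borel)) \<and>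
       (\<forall>q Y. \<bar>pol q t Y\<bar> \<le> b))"

text \<open>
  A randomized learning algorithm using \<open>n\<close> trajectories, with inputs bounded by \<open>b\<close>. A seed
  \<open>r\<close> is drawn from \<open>R\<close>; at time \<open>t\<close> of trajectory \<open>i\<close> it plays \<open>act r i D t Y\<close>, where \<open>D\<close>
  collects the records of trajectories \<open>0, \<dots>, i - 1\<close> and \<open>Y\<close> is the current record up to
  time \<open>t\<close>; from the records \<open>D\<close> of all \<open>n\<close> trajectories it outputs the decoder \<open>out r D\<close>.
\<close>

definition learning_algorithm ::
  "nat \<Rightarrow> nat \<Rightarrow> real \<Rightarrow> real measure \<Rightarrow>
   (real \<Rightarrow> nat \<Rightarrow> (nat \<Rightarrow> obs_seq) \<Rightarrow> nat \<Rightarrow> obs_seq \<Rightarrow> real) \<Rightarrow>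
   (real \<Rightarrow> (nat \<Rightarrow> obs_seq) \<Rightarrow> real \<Rightarrow> real) \<Rightarrow> bool"
where
  "learning_algorithm n T b R act out \<longleftrightarrow>
     prob_space R \<and> sets R = sets borel \<and>
     (\<forall>i<n. \<forall>t\<le>T.
       (\<lambda>(r, D, Y). act r i D t Y) \<in>
         borel_measurable (borel \<Otimes>\<^sub>M data_space T i \<Otimes>\<^sub>M Pi\<^sub>M {..t} (\<lambda>_. borel)) \<and>
       (\<forall>r D Y. \<bar>act r i D t Y\<bar> \<le> b)) \<and>
     (\<lambda>(r, D, y). out r D y) \<in> borel_measurable (borel \<Otimes>\<^sub>M data_space T n \<Otimes>\<^sub>M borel)"

text \<open>The records of the first \<open>i\<close> trajectories, when trajectory \<open>j\<close> has noise \<open>\<omega> j\<close>.\<close>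

primrec collected_data ::
  "(real \<Rightarrow> real) \<Rightarrow> real \<Rightarrow> real \<Rightarrow> real \<Rightarrow> nat \<Rightarrow>
   (nat \<Rightarrow> (nat \<Rightarrow> obs_seq) \<Rightarrow> nat \<Rightarrow> obs_seq \<Rightarrow> real) \<Rightarrow>
   (nat \<Rightarrow> (nat \<Rightarrow> real) \<times> (nat \<Rightarrow> real)) \<Rightarrow> nat \<Rightarrow> (nat \<Rightarrow> obs_seq)"
where
  "collected_data f A B x0 T a \<omega> 0 = (\<lambda>_. undefined)"
| "collected_data f A B x0 T a \<omega> (Suc i) =
     (let D = collected_data f A B x0 T a \<omega> i
      in D(i := observations f A B x0 (a i D) (\<omega> i) T))"

text \<open>
  Expected squared error, over learning and over an independent trajectory under the roll-in
  policy, of the learned decoder at the (noisy) observation at time \<open>t\<close>. It is an extended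
  nonnegative real, so that it is meaningful also when the error is not integrable.
\<close>

definition expected_error ::
  "(real \<Rightarrow> real) \<Rightarrow> real \<Rightarrow> real \<Rightarrow> real \<Rightarrow> nat \<Rightarrow> nat \<Rightarrow> nat \<Rightarrow> real measure \<Rightarrow>
   (real \<Rightarrow> nat \<Rightarrow> (nat \<Rightarrow> obs_seq) \<Rightarrow> nat \<Rightarrow> obs_seq \<Rightarrow> real) \<Rightarrow>
   (real \<Rightarrow> (nat \<Rightarrow> obs_seq) \<Rightarrow> real \<Rightarrow> real) \<Rightarrow>
   real measure \<Rightarrow> (real \<Rightarrow> nat \<Rightarrow> obs_seq \<Rightarrow> real) \<Rightarrow> ennreal"
where
  "expected_error f A B x0 n T t R act out Q pol =
     (\<integral>\<^sup>+ r. \<integral>\<^sup>+ \<omega>. 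
        (let fhat = out r (collected_data f A B x0 T (act r) \<omega> n) in
         \<integral>\<^sup>+ q. \<integral>\<^sup>+ \<xi>.
           (let y = observations f A B x0 (pol q) \<xi> T t in ennreal ((fhat y - f y)\<^sup>2))
         \<partial>noise T \<partial>Q)
      \<partial>Pi\<^sub>M {..<n} (\<lambda>_. noise T) \<partial>R)"

end

theory Submission
  imports Defs
begin

text \<open>
  Take \<open>A = B = 0\<close> and \<open>x 0 = 0\<close>, so that the inputs have no influence. With
  \<open>k = sqrt (20 ln n)\<close> and \<open>s = \<plusminus>1\<close>, the decoder \<open>f s\<close> is defined by
  \<open>\<Phi> (f s z) = \<Phi> (2 z) + s G z\<close>, where \<open>\<Phi>\<close> is an antiderivative of the standard
  normal density \<open>\<phi>\<close> and \<open>G z = \<phi> (3 z) sin (k z) / (16 k)\<close>; then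
  \<open>f s\<close> is a small perturbation of \<open>2 z\<close> and the noiseless observation \<open>(f s)\<^sup>-\<^sup>1 (w 0)\<close> has the
  explicit density \<open>2 \<phi> (2 z) + s G' z\<close>. The output noise convolves this with \<open>\<phi>\<close>, which damps
  the oscillation of \<open>G'\<close> by the factor \<open>exp (- k\<^sup>2 / 20) = 1 / n\<close>. Hence the two laws of one
  record have a common part of mass \<open>1 - O(1 / n)\<close>, and those of \<open>n\<close> records one of mass bounded
  below. On this common part the algorithm has to approximate both decoders at once, although
  they differ by about \<open>1 / k\<close>, so one of the two squared errors is at least of order
  \<open>1 / k\<^sup>2\<close>, that is \<open>1 / ln n\<close>, which is more than is needed.
\<close>

section \<open>The decoders\<close>

abbreviation phi :: "real \<Rightarrow> real" where "phi \<equiv> std_normal_density"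

abbreviation N01 :: "real measure" where "N01 \<equiv> std_normal_distribution"

lemma prob_space_N01: "prob_space N01"
  by (rule prob_space_normal_density) simp

text \<open>Any antiderivative serves: below only differences of \<open>Phi\<close> occur, and
  \<open>inv Phi\<close> at arguments of the form \<open>Phi (2 * z)\<close> plus a shift, and
  neither changes when a constant is added to \<open>Phi\<close>.\<close>

definition Phi :: "real \<Rightarrow> real" where
  "Phi = (SOME F. \<forall>x. (F has_real_derivative phi x) (at x))"

lemma isCont_phi [continuous_intros]: "isCont phi x"
  unfolding normal_density_def by (intro continuous_intros) auto

lemma DERIV_Phi: "(Phi has_real_derivative phi x) (at x)"
proof -
  have "\<exists>F. \<forall>x. -\<infinity> < ereal x \<longrightarrow> ereal x < \<infinity> \<longrightarrow> (F has_vector_derivative phi x) (at x)"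
    by (rule einterval_antiderivative) (auto intro: isCont_phi)
  then have "\<exists>F. \<forall>x. (F has_real_derivative phi x) (at x)"
    by (simp add: has_real_derivative_iff_has_vector_derivative)
  from someI_ex[OF this] show ?thesis
    by (simp add: Phi_def)
qed

lemma phi_pos [simp]: "phi x > 0"
  by (simp add: normal_density_pos)

lemma strict_mono_Phi: "strict_mono Phi"
proof (rule strict_monoI)
  fix x y :: real assume "x < y"
  then show "Phi x < Phi y"
    by (rule DERIV_pos_imp_increasing) (use DERIV_Phi phi_pos in blast)
qed

lemma continuous_on_Phi: "continuous_on A Phi"
  by (rule DERIV_continuous_on) (rule has_field_derivative_at_within[OF DERIV_Phi])

lemma phi_le: "phi x \<le> 1 / sqrt (2 * pi)"
  by (auto simp: normal_density_def intro!: divide_right_mono)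

lemma Phi_diff_le: "\<bar>Phi x - Phi y\<bar> \<le> \<bar>x - y\<bar> / sqrt (2 * pi)"
proof -
  have "norm (Phi x - Phi y) \<le> 1 / sqrt (2 * pi) * norm (x - y)"
    by (rule field_differentiable_bound[where S=UNIV and f'=phi])
      (use phi_le DERIV_Phi in auto)
  then show ?thesis by simp
qed

section \<open>Comparison of the normal density near \<open>2 * z\<close> with its value
  there\<close>

lemma phi_ratio: "phi y = phi x * exp (x\<^sup>2 / 2 - y\<^sup>2 / 2)"
  by (simp add: normal_density_def mult_exp_exp algebra_simps)

text \<open>With \<open>d = x - 2 * z\<close> the difference is
  \<open>- 2 * z * d - d\<^sup>2 / 2\<close>. The window shrinks like 1 / |z|, so
  \<open>z * d\<close> stays bounded; by \<open>phi_ratio\<close> the density then varies over the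
  window by at most an absolute factor, uniformly in \<open>z\<close>.\<close>

lemma half_square_diff_le:
  fixes x z :: real
  assumes "\<bar>x - 2 * z\<bar> \<le> 1 / (8 * (1 + \<bar>z\<bar>))"
  shows "\<bar>(2 * z)\<^sup>2 / 2 - x\<^sup>2 / 2\<bar> \<le> 17 / 64"
proof -
  define d where "d = x - 2 * z"
  have 1: "1 / (8 * (1 + \<bar>z\<bar>)) \<le> 1 / 8"
    by (simp add: field_simps)
  have d: "\<bar>d\<bar> \<le> 1 / 8" unfolding d_def by (rule order_trans[OF assms 1])
  have dz: "\<bar>z\<bar> * \<bar>d\<bar> \<le> 1 / 8"
  proof -
    have "\<bar>z\<bar> * \<bar>d\<bar> \<le> \<bar>z\<bar> * (1 / (8 * (1 + \<bar>z\<bar>)))"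
      using assms unfolding d_def by (intro mult_left_mono) auto
    also have "\<dots> \<le> 1 / 8" by (simp add: field_simps)
    finally show ?thesis .
  qed
  have "(2 * z)\<^sup>2 / 2 - x\<^sup>2 / 2 = - (2 * (z * d)) - d\<^sup>2 / 2"
    unfolding d_def by (simp add: power2_eq_square field_simps)
  also have "\<bar>\<dots>\<bar> \<le> 2 * (\<bar>z\<bar> * \<bar>d\<bar>) + \<bar>d\<bar>\<^sup>2 / 2"
    unfolding abs_mult[of z d, symmetric] power2_abs using zero_le_power2[of d] by linarith
  also have "\<dots> \<le> 2 * (1 / 8) + (1 / 8)\<^sup>2 / 2"
    using dz power_mono[OF d abs_ge_zero, of 2] by linarith
  also have "\<dots> \<le> 17 / 64" by (simp add: power2_eq_square)
  finally show ?thesis .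
qed

text \<open>On the window of half-width \<open>h\<close> the density is at least half of
  \<open>phi (2 * z)\<close>, and the mean value theorem turns this into an increment of
  \<open>Phi\<close>. This is the room available for the perturbation.\<close>

lemma Phi_displace:
  fixes z :: real
  defines "h \<equiv> 1 / (8 * (1 + \<bar>z\<bar>))"
  shows "Phi (2 * z + h) - Phi (2 * z) \<ge> h / 2 * phi (2 * z)"
    and "Phi (2 * z) - Phi (2 * z - h) \<ge> h / 2 * phi (2 * z)"
proof -
  have h: "h > 0" by (simp add: h_def)
  have low: "phi x \<ge> phi (2 * z) / 2" if "\<bar>x - 2 * z\<bar> \<le> h" for x
  proof -
    have "(2 * z)\<^sup>2 / 2 - x\<^sup>2 / 2 \<ge> - (17 / 64)"
      using half_square_diff_le[of x z] that unfolding h_def by linarith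
    moreover have "exp (- (17 / 64)) \<ge> (1/2::real)"
      using exp_ge_add_one_self[of "- (17 / 64) :: real"] by simp
    ultimately have "exp ((2 * z)\<^sup>2 / 2 - x\<^sup>2 / 2) \<ge> 1 / 2"
      by (meson exp_le_cancel_iff order_trans)
    then have "phi (2 * z) * exp ((2 * z)\<^sup>2 / 2 - x\<^sup>2 / 2) \<ge> phi (2 * z) * (1 / 2)"
      by (intro mult_left_mono) (auto intro: less_imp_le)
    then show ?thesis by (subst phi_ratio[of x "2 * z"]) simp
  qed
  have *: "Phi b - Phi a \<ge> h / 2 * phi (2 * z)"
    if "b - a = h" "\<And>x. a < x \<Longrightarrow> x < b \<Longrightarrow> \<bar>x - 2 * z\<bar> \<le> h" for a b
  proof -
    have "a < b" using that h by simp
    from MVT2[OF this, of Phi phi] DERIV_Phi obtain x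
      where x: "a < x" "x < b" "Phi b - Phi a = (b - a) * phi x" by blast
    have "h * phi x \<ge> h * (phi (2 * z) / 2)"
      using low[OF that(2)[OF x(1,2)]] h by (intro mult_left_mono) auto
    then show ?thesis using x that by simp
  qed
  show "Phi (2 * z + h) - Phi (2 * z) \<ge> h / 2 * phi (2 * z)" by (rule *) auto
  show "Phi (2 * z) - Phi (2 * z - h) \<ge> h / 2 * phi (2 * z)" by (rule *) auto
qed

section \<open>The oscillating perturbation and its derivative\<close>

definition bump :: "real \<Rightarrow> real \<Rightarrow> real" where
  "bump k z = phi (3 * z) * sin (k * z) / (16 * k)"

definition bump' :: "real \<Rightarrow> real \<Rightarrow> real" where
  "bump' k z = phi (3 * z) * (cos (k * z) - 9 * z * (sin (k * z) / k)) / 16"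

lemma measurable_bump' [measurable]: "bump' k \<in> borel_measurable borel"
  unfolding bump'_def by measurable

lemma DERIV_phi: "(phi has_real_derivative - x * phi x) (at x)"
  unfolding normal_density_def
  by (rule derivative_eq_intros refl | simp)+

lemma DERIV_bump: "k \<noteq> 0 \<Longrightarrow> (bump k has_real_derivative bump' k z) (at z)"
  unfolding bump_def bump'_def
  by (rule derivative_eq_intros DERIV_fun_sin refl DERIV_chain2[OF DERIV_phi] | simp add: field_simps)+

lemma phi_thrice: "phi (3 * z) = phi (2 * z) * exp (- 5 * z\<^sup>2 / 2)"
  by (subst phi_ratio[of _ "2 * z"]) (simp add: power2_eq_square algebra_simps)

lemma abs_sin_div_le:
  fixes k z :: real
  assumes "k > 0"
  shows "\<bar>sin (k * z) / k\<bar> \<le> \<bar>z\<bar>"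
  using abs_sin_x_le_abs_x[of "k * z"] assms by (simp add: abs_mult field_simps)

lemma exp_neg_mult_le_1: "exp (- 5 * z\<^sup>2 / 2) * (1 + 5 * z\<^sup>2 / 2) \<le> (1::real)"
proof -
  have "exp (- 5 * z\<^sup>2 / 2) * (1 + 5 * z\<^sup>2 / 2) \<le> exp (- 5 * z\<^sup>2 / 2) * exp (5 * z\<^sup>2 / 2)"
    by (intro mult_left_mono exp_ge_add_one_self) auto
  then show ?thesis by (simp add: exp_add[symmetric])
qed

text \<open>The bound |sin (k z) / k| \<le> |z| removes \<open>k\<close>, and the faster decay of
  \<open>phi (3 * z)\<close> against \<open>phi (2 * z)\<close> absorbs the polynomial factor |z| (1
  + |z|). The right-hand side is exactly the increment \<open>h / 2 * phi (2 * z)\<close> of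
  \<open>Phi_displace\<close>.\<close>

lemma bump_bound:
  assumes "k > 0"
  shows "\<bar>bump k z\<bar> \<le> phi (2 * z) / (16 * (1 + \<bar>z\<bar>))"
proof -
  have "\<bar>bump k z\<bar> = phi (3 * z) * \<bar>sin (k * z) / k\<bar> / 16"
    using assms by (simp add: bump_def abs_mult less_imp_le)
  also have "\<dots> \<le> phi (3 * z) * \<bar>z\<bar> / 16"
    by (intro divide_right_mono mult_left_mono abs_sin_div_le assms) (auto intro: less_imp_le)
  also have "\<dots> = phi (2 * z) * (exp (- 5 * z\<^sup>2 / 2) * (\<bar>z\<bar> * (1 + \<bar>z\<bar>))) / (16 * (1 + \<bar>z\<bar>))"
    unfolding phi_thrice by (simp add: nonzero_divide_eq_eq nonzero_eq_divide_eq add_pos_nonneg)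
  also have "\<dots> \<le> phi (2 * z) * 1 / (16 * (1 + \<bar>z\<bar>))"
  proof (intro divide_right_mono mult_left_mono)
    have "0 \<le> (\<bar>z\<bar> - 1)\<^sup>2" by simp
    then have "2 * \<bar>z\<bar> \<le> 1 + z\<^sup>2" by (simp add: power2_diff)
    moreover have "\<bar>z\<bar> * (1 + \<bar>z\<bar>) = \<bar>z\<bar> + z\<^sup>2" by (simp add: power2_eq_square algebra_simps)
    ultimately have "\<bar>z\<bar> * (1 + \<bar>z\<bar>) \<le> 1 + 5 * z\<^sup>2 / 2"
      using zero_le_power2[of z] by argo
    then have "exp (- 5 * z\<^sup>2 / 2) * (\<bar>z\<bar> * (1 + \<bar>z\<bar>)) \<le> exp (- 5 * z\<^sup>2 / 2) * (1 + 5 * z\<^sup>2 / 2)"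
      by (intro mult_left_mono) auto
    then show "exp (- 5 * z\<^sup>2 / 2) * (\<bar>z\<bar> * (1 + \<bar>z\<bar>)) \<le> 1"
      using exp_neg_mult_le_1[of z] by linarith
  qed (auto intro: less_imp_le)
  finally show ?thesis by simp
qed

text \<open>The division by \<open>k\<close> in \<open>bump\<close> makes the bound uniform in
  \<open>k\<close>; the quadratic growth of the bracket is again absorbed by
  \<open>phi_thrice\<close>. The constant 1/4 keeps \<open>2 * phi (2 * z) + s * bump' k z\<close>
  positive and comparable to \<open>phi (2 * z)\<close>.\<close>

lemma bump'_bound:
  assumes "k > 0"
  shows "\<bar>bump' k z\<bar> \<le> phi (2 * z) / 4"
proof -
  have "\<bar>cos (k * z) - 9 * z * (sin (k * z) / k)\<bar> \<le> \<bar>cos (k * z)\<bar> + \<bar>9 * z * (sin (k * z) / k)\<bar>"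
    by (rule abs_triangle_ineq4)
  also have "\<dots> \<le> 1 + 9 * \<bar>z\<bar> * \<bar>z\<bar>"
  proof (rule add_mono)
    have "\<bar>9 * z * (sin (k * z) / k)\<bar> = 9 * \<bar>z\<bar> * \<bar>sin (k * z) / k\<bar>"
      by (simp only: abs_mult abs_numeral)
    then show "\<bar>9 * z * (sin (k * z) / k)\<bar> \<le> 9 * \<bar>z\<bar> * \<bar>z\<bar>"
      using abs_sin_div_le[OF assms, of z] by (simp only:) (intro mult_left_mono, auto)
  qed simp
  also have "\<dots> = 1 + 9 * z\<^sup>2" by (simp add: power2_eq_square)
  also have "\<dots> \<le> 4 * (1 + 5 * z\<^sup>2 / 2)" by simp
  finally have "phi (3 * z) * \<bar>cos (k * z) - 9 * z * (sin (k * z) / k)\<bar> \<le> phi (3 * z) * (4 * (1 + 5 * z\<^sup>2 / 2))"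
    by (intro mult_left_mono) (auto intro: less_imp_le)
  also have "\<dots> = 4 * phi (2 * z) * (exp (- 5 * z\<^sup>2 / 2) * (1 + 5 * z\<^sup>2 / 2))"
    by (simp add: phi_thrice)
  also have "\<dots> \<le> 4 * phi (2 * z) * 1"
    by (intro mult_left_mono exp_neg_mult_le_1) (auto intro: less_imp_le)
  finally show ?thesis by (simp add: bump'_def abs_mult less_imp_le)
qed

section \<open>Inversion of \<open>Phi\<close>, smoothness and bijectivity of the decoders\<close>

definition decoder :: "real \<Rightarrow> real \<Rightarrow> real \<Rightarrow> real" where
  "decoder k s z = inv Phi (Phi (2 * z) + s * bump k z)"

lemma inv_Phi: "inv Phi (Phi x) = x"
  by (simp add: strict_mono_Phi strict_mono_imp_inj_on)

context
  fixes k s :: real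
  assumes k: "k > 0" and s: "\<bar>s\<bar> \<le> 1"
begin

text \<open>\<open>Phi\<close> is not onto the reals, so \<open>inv Phi\<close> is meaningful only
  where its argument is attained. \<open>bump_bound\<close> and \<open>Phi_displace\<close> place
  the argument between the values of \<open>Phi\<close> at \<open>2 * z - h\<close> and
  \<open>2 * z + h\<close>, and the intermediate value theorem yields a preimage in that
  window.\<close>

lemma decoder:
  shows Phi_decoder: "Phi (decoder k s z) = Phi (2 * z) + s * bump k z"
    and decoder_near: "\<bar>decoder k s z - 2 * z\<bar> \<le> 1 / (8 * (1 + \<bar>z\<bar>))"
proof -
  define h where "h = 1 / (8 * (1 + \<bar>z\<bar>))"
  have h: "h > 0" by (simp add: h_def)
  have "\<bar>s * bump k z\<bar> \<le> 1 * (phi (2 * z) / (16 * (1 + \<bar>z\<bar>)))"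
    unfolding abs_mult by (intro mult_mono s bump_bound k) auto
  also have "\<dots> = h / 2 * phi (2 * z)" by (simp add: h_def)
  finally have b: "\<bar>s * bump k z\<bar> \<le> h / 2 * phi (2 * z)" .
  have "\<exists>x\<ge>2 * z - h. x \<le> 2 * z + h \<and> Phi x = Phi (2 * z) + s * bump k z"
    using b h Phi_displace[of z, folded h_def]
    by (intro IVT') (auto simp: continuous_on_Phi)
  then obtain x where x: "2 * z - h \<le> x" "x \<le> 2 * z + h" "Phi x = Phi (2 * z) + s * bump k z"
    by blast
  then have "decoder k s z = x" unfolding decoder_def by (metis inv_Phi)
  with x show "Phi (decoder k s z) = Phi (2 * z) + s * bump k z"
    "\<bar>decoder k s z - 2 * z\<bar> \<le> 1 / (8 * (1 + \<bar>z\<bar>))" by (auto simp: h_def)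
qed

lemma DERIV_decoder:
  "(decoder k s has_real_derivative (2 * phi (2 * z) + s * bump' k z) / phi (decoder k s z)) (at z)"
proof -
  have "(inv Phi has_real_derivative inverse (phi (decoder k s z))) (at (Phi (decoder k s z)))"
    unfolding has_field_derivative_def
    by (rule has_derivative_inverse_strong[where S=UNIV and f'="(*) (phi (decoder k s z))"])
      (use DERIV_Phi in \<open>auto simp: has_field_derivative_def continuous_on_Phi inv_Phi fun_eq_iff less_imp_neq[symmetric]\<close>)
  then have "(inv Phi has_real_derivative inverse (phi (decoder k s z))) (at (Phi (2 * z) + s * bump k z))"
    by (simp add: Phi_decoder)
  moreover have "((\<lambda>z. Phi (2 * z) + s * bump k z) has_real_derivative 2 * phi (2 * z) + s * bump' k z) (at z)"
    using k by (auto intro!: derivative_eq_intros DERIV_chain2[OF DERIV_Phi] DERIV_bump)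
  ultimately have "((\<lambda>z. inv Phi (Phi (2 * z) + s * bump k z)) has_real_derivative
      inverse (phi (decoder k s z)) * (2 * phi (2 * z) + s * bump' k z)) (at z)"
    by (rule DERIV_chain2)
  then show ?thesis
    unfolding decoder_def[abs_def] by (simp add: field_simps)
qed

lemma latent_density_bounds:
  "7 / 4 * phi (2 * z) \<le> 2 * phi (2 * z) + s * bump' k z"
  "2 * phi (2 * z) + s * bump' k z \<le> 9 / 4 * phi (2 * z)"
proof -
  have "\<bar>s * bump' k z\<bar> \<le> 1 * (phi (2 * z) / 4)"
    unfolding abs_mult by (intro mult_mono s bump'_bound k) auto
  then show "7 / 4 * phi (2 * z) \<le> 2 * phi (2 * z) + s * bump' k z"
    "2 * phi (2 * z) + s * bump' k z \<le> 9 / 4 * phi (2 * z)" by linarith+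
qed

text \<open>The derivative is the quotient of the latent density, which is within [7/4, 9/4] times
  \<open>phi (2 * z)\<close>, by \<open>phi x\<close> with \<open>x\<close> close to
  \<open>2 * z\<close>. As \<open>phi (2 * z) / phi x\<close> lies in [47/64, 7/4], the quotient
  lies in [329/256, 63/16].\<close>

lemma deriv_decoder_bounds:
  "1 \<le> deriv (decoder k s) z" "deriv (decoder k s) z \<le> 4"
proof -
  define x where "x = decoder k s z"
  have e: "\<bar>x\<^sup>2 / 2 - (2 * z)\<^sup>2 / 2\<bar> \<le> 17 / 64"
    using half_square_diff_le[OF decoder_near[of z]] unfolding x_def by linarith
  have r: "phi (2 * z) = phi x * exp (x\<^sup>2 / 2 - (2 * z)\<^sup>2 / 2)" by (rule phi_ratio)
  have d: "deriv (decoder k s) z = (2 * phi (2 * z) + s * bump' k z) / phi x"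
    unfolding x_def by (rule DERIV_imp_deriv[OF DERIV_decoder])
  have "exp (x\<^sup>2 / 2 - (2 * z)\<^sup>2 / 2) \<ge> 1 + - (17 / 64)"
    using exp_ge_add_one_self[of "x\<^sup>2 / 2 - (2 * z)\<^sup>2 / 2"] e by linarith
  then have "phi x * (1 + - (17 / 64)) \<le> phi (2 * z)"
    unfolding r by (intro mult_left_mono) (auto intro: less_imp_le)
  then have lo: "phi (2 * z) \<ge> 47 / 64 * phi x" by simp
  have "exp (x\<^sup>2 / 2 - (2 * z)\<^sup>2 / 2) \<le> exp (1 / 2)"
    using e by (intro exp_le_cancel_iff[THEN iffD2]) linarith
  also have "exp (1 / 2) \<le> 1 + 1 / 2 + (1 / 2 :: real)\<^sup>2"
    by (rule exp_bound) auto
  finally have hi: "phi (2 * z) \<le> phi x * (7 / 4)"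
    unfolding r by (intro mult_left_mono) (auto intro: less_imp_le simp: power2_eq_square)
  show "1 \<le> deriv (decoder k s) z"
    unfolding d using latent_density_bounds(1)[of z] lo phi_pos[of x] by (subst le_divide_eq_1_pos) linarith+
  show "deriv (decoder k s) z \<le> 4"
    unfolding d using latent_density_bounds(2)[of z] hi phi_pos[of x] by (subst pos_divide_le_eq) linarith+
qed

lemma decoder_differentiable: "decoder k s differentiable (at z)"
  unfolding real_differentiable_def by (rule exI) (rule DERIV_decoder)

lemma DERIV_deriv_decoder: "(decoder k s has_real_derivative deriv (decoder k s) z) (at z)"
  using DERIV_imp_deriv[OF DERIV_decoder] DERIV_decoder by simp

lemma continuous_on_decoder: "continuous_on A (decoder k s)"
  by (rule DERIV_continuous_on) (rule has_field_derivative_at_within[OF DERIV_decoder])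

lemma lipschitz_decoder: "4-lipschitz_on UNIV (decoder k s)"
proof (rule lipschitz_onI)
  fix x y
  have "\<bar>deriv (decoder k s) z\<bar> \<le> 4" for z
    using deriv_decoder_bounds[of z] by linarith
  then have "norm (decoder k s x - decoder k s y) \<le> 4 * norm (x - y)"
    using DERIV_deriv_decoder
    by (intro field_differentiable_bound[where S=UNIV and f'="deriv (decoder k s)"]) auto
  then show "dist (decoder k s x) (decoder k s y) \<le> 4 * dist x y" by (simp add: dist_norm)
qed simp

lemma strict_mono_decoder: "strict_mono (decoder k s)"
proof (rule strict_monoI)
  fix x y :: real assume "x < y"
  then show "decoder k s x < decoder k s y"
    by (rule DERIV_pos_imp_increasing)
      (use DERIV_deriv_decoder deriv_decoder_bounds(1) in \<open>blast intro: less_le_trans zero_less_one\<close>)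
qed

lemma bij_decoder: "bij (decoder k s)"
proof (rule bijI)
  show "inj (decoder k s)" using strict_mono_decoder strict_mono_imp_inj_on by blast
  show "surj (decoder k s)"
    unfolding surj_def
  proof
    fix w
    have n: "\<bar>decoder k s z - 2 * z\<bar> \<le> 1" for z
    proof -
      have "1 / (8 * (1 + \<bar>z\<bar>)) \<le> 1" by (simp add: field_simps)
      with decoder_near[of z] show ?thesis by linarith
    qed
    \<comment> \<open>The decoder stays within 1 of \<open>2 * z\<close>, so its value is at most
      \<open>w - 1\<close> at the left end point and at least \<open>w + 1\<close> at the right
      one.\<close>
    have "\<exists>x\<ge>w / 2 - 1. x \<le> w / 2 + 1 \<and> decoder k s x = w"
      using n[of "w / 2 - 1"] n[of "w / 2 + 1"]
      by (intro IVT') (auto simp: continuous_on_decoder)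
    then show "\<exists>x. w = decoder k s x" by blast
  qed
qed

text \<open>Since the state starts at 0, this makes the first observation pure output noise under
  both decoders.\<close>

lemma inv_decoder_0: "inv (decoder k s) 0 = 0"
proof -
  have "decoder k s 0 = 0" by (simp add: decoder_def bump_def inv_Phi)
  then show ?thesis using bij_decoder by (metis bij_inv_eq_iff)
qed

end

text \<open>The values of \<open>Phi\<close> at the two decoders differ by
  \<open>2 * bump k y\<close>, and \<open>Phi\<close> is Lipschitz with constant
  \<open>1 / sqrt (2 * pi)\<close>, which cancels the normalisation inside \<open>bump\<close>. The
  factor \<open>exp (- 9 / 2)\<close> is the least value of the unnormalised
  \<open>phi (3 * y)\<close> on [0, 1].\<close>

lemma decoder_diff_ge:
  assumes k: "k > 0" and "0 \<le> y" "y \<le> 1"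
  shows "\<bar>decoder k 1 y - decoder k (-1) y\<bar> \<ge> exp (- 9 / 2) * \<bar>sin (k * y)\<bar> / (8 * k)"
proof -
  have "Phi (decoder k 1 y) - Phi (decoder k (-1) y) = 2 * bump k y"
    using Phi_decoder[OF k, of 1 y] Phi_decoder[OF k, of "-1" y] by simp
  then have "2 * \<bar>bump k y\<bar> \<le> \<bar>decoder k 1 y - decoder k (-1) y\<bar> / sqrt (2 * pi)"
    using Phi_diff_le[of "decoder k 1 y" "decoder k (-1) y"] by (simp add: abs_mult)
  moreover have "phi (3 * y) \<ge> exp (- 9 / 2) / sqrt (2 * pi)"
  proof -
    have "y\<^sup>2 \<le> 1" using assms by (simp add: power_le_one)
    then show ?thesis by (simp add: normal_density_def field_simps power2_eq_square)
  qed
  then have "exp (- 9 / 2) / sqrt (2 * pi) * \<bar>sin (k * y)\<bar> / (16 * k) \<le> \<bar>bump k y\<bar>"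
  proof -
    assume *: "exp (- 9 / 2) / sqrt (2 * pi) \<le> phi (3 * y)"
    have "\<bar>bump k y\<bar> = phi (3 * y) * \<bar>sin (k * y)\<bar> / (16 * k)"
      using k by (simp add: bump_def abs_mult less_imp_le)
    also have "\<dots> \<ge> exp (- 9 / 2) / sqrt (2 * pi) * \<bar>sin (k * y)\<bar> / (16 * k)"
      using k by (intro divide_right_mono mult_right_mono *) auto
    finally show ?thesis .
  qed
  ultimately have "2 * (exp (- 9 / 2) / sqrt (2 * pi) * \<bar>sin (k * y)\<bar> / (16 * k))
     \<le> \<bar>decoder k 1 y - decoder k (-1) y\<bar> / sqrt (2 * pi)" by linarith
  then show ?thesis using k by (simp add: field_simps)
qed

section \<open>Gaussian smoothing of the perturbation\<close>

lemma integrable_phi_times: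
  fixes g :: "real \<Rightarrow> real"
  assumes [measurable]: "g \<in> borel_measurable borel" and "\<And>x. \<bar>g x\<bar> \<le> 1"
  shows "integrable lborel (\<lambda>x. phi x * (x ^ j * g x))"
proof (rule Bochner_Integration.integrable_bound[OF integrable_std_normal_moment_abs[of j]])
  have "phi x * \<bar>x\<bar> ^ j * \<bar>g x\<bar> \<le> phi x * \<bar>x\<bar> ^ j * 1" for x
    using assms(2) by (intro mult_left_mono) (auto intro!: mult_nonneg_nonneg less_imp_le)
  then show "AE x in lborel. norm (phi x * (x ^ j * g x)) \<le> norm (phi x * \<bar>x\<bar> ^ j)"
    by (intro AE_I2) (simp add: abs_mult power_abs less_imp_le mult.assoc)
qed measurable

lemma integral_odd_eq_0:
  fixes f :: "real \<Rightarrow> real"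
  assumes "\<And>x. f (- x) = - f x"
  shows "(\<integral>x. f x \<partial>lborel) = 0"
proof -
  have "(\<integral>x. f x \<partial>lborel) = (\<integral>x. f (0 + - 1 * x) \<partial>lborel)"
    by (subst lborel_integral_real_affine[of "-1" _ 0]) auto
  also have "\<dots> = - (\<integral>x. f x \<partial>lborel)"
    by (simp add: assms)
  finally show ?thesis by simp
qed

text \<open>This is the real part of the characteristic function of the standard normal law.\<close>

lemma has_bochner_integral_phi_cos:
  "has_bochner_integral lborel (\<lambda>x. phi x * cos (t * x)) (exp (- t\<^sup>2 / 2))"
unfolding has_bochner_integral_iff
proof
  show "integrable lborel (\<lambda>x. phi x * cos (t * x))"
    using integrable_phi_times[of "\<lambda>x. cos (t * x)" 0] by simp
  have "(\<integral>x. phi x *\<^sub>R iexp (t * x) \<partial>lborel) = char std_normal_distribution t"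
    unfolding char_def by (subst integral_density) auto
  then have eq: "(\<integral>x. phi x *\<^sub>R iexp (t * x) \<partial>lborel) = complex_of_real (exp (- t\<^sup>2 / 2))"
    by (simp add: char_std_normal_distribution)
  \<comment> \<open>The Bochner integral of a non-integrable function is 0 by convention, whereas
    this one is an exponential and hence nonzero.\<close>
  have "integrable lborel (\<lambda>x. phi x *\<^sub>R iexp (t * x))"
    using eq not_integrable_integral_eq by fastforce
  then have "(\<integral>x. Re (phi x *\<^sub>R iexp (t * x)) \<partial>lborel) = Re (\<integral>x. phi x *\<^sub>R iexp (t * x) \<partial>lborel)"
    by (rule integral_Re)
  then show "(\<integral>x. phi x * cos (t * x) \<partial>lborel) = exp (- t\<^sup>2 / 2)"
    unfolding eq by (simp add: Re_exp)
qed

lemma has_bochner_integral_phi_sin: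
  "has_bochner_integral lborel (\<lambda>x. phi x * sin (t * x)) 0"
unfolding has_bochner_integral_iff
proof
  show "integrable lborel (\<lambda>x. phi x * sin (t * x))"
    using integrable_phi_times[of "\<lambda>x. sin (t * x)" 0] by simp
  show "(\<integral>x. phi x * sin (t * x) \<partial>lborel) = 0"
    by (rule integral_odd_eq_0) (simp add: normal_density_def)
qed

lemma has_bochner_integral_phi_id_cos:
  "has_bochner_integral lborel (\<lambda>x. phi x * (x * cos (t * x))) 0"
unfolding has_bochner_integral_iff
proof
  show "integrable lborel (\<lambda>x. phi x * (x * cos (t * x)))"
    using integrable_phi_times[of "\<lambda>x. cos (t * x)" 1] by simp
  show "(\<integral>x. phi x * (x * cos (t * x)) \<partial>lborel) = 0"
    by (rule integral_odd_eq_0) (simp add: normal_density_def)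
qed

lemma phi_tendsto_0: "(phi \<longlongrightarrow> 0) at_top" "(phi \<longlongrightarrow> 0) at_bot"
  unfolding normal_density_def by real_asymp+

text \<open>Integration by parts: \<open>g\<close> is the derivative of
  \<open>phi x * sin (t * x)\<close>, which vanishes at both infinities, so \<open>g\<close>
  integrates to 0 and the claim reduces to the cosine integral.\<close>

lemma has_bochner_integral_phi_id_sin:
  "has_bochner_integral lborel (\<lambda>x. phi x * (x * sin (t * x))) (t * exp (- t\<^sup>2 / 2))"
proof -
  note c = has_bochner_integral_phi_cos[of t]
  have i: "integrable lborel (\<lambda>x. phi x * (x * sin (t * x)))"
    using integrable_phi_times[of "\<lambda>x. sin (t * x)" 1] by simp
  define g where "g x = t * (phi x * cos (t * x)) - phi x * (x * sin (t * x))" for x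
  have gi: "integrable lborel g"
    unfolding g_def using c i by (auto dest: has_bochner_integral_iff[THEN iffD1])
  have lim: "((\<lambda>x. phi x * sin (t * x)) \<longlongrightarrow> 0) F" if "(phi \<longlongrightarrow> 0) F" for F
    using that by (rule Lim_null_comparison[rotated])
      (auto simp: abs_mult less_imp_le intro!: always_eventually mult_left_le)
  have "(LBINT x=-\<infinity>..\<infinity>. g x) = 0 - 0"
  proof (rule interval_integral_FTC_integrable[where F="\<lambda>x. phi x * sin (t * x)"])
    fix x
    show "((\<lambda>x. phi x * sin (t * x)) has_vector_derivative g x) (at x)"
      unfolding has_real_derivative_iff_has_vector_derivative[symmetric] g_def
      by (rule derivative_eq_intros refl DERIV_chain2[OF DERIV_phi] DERIV_phi | simp add: algebra_simps)+
    show "isCont g x" unfolding g_def by (intro continuous_intros isCont_phi)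
  next
    show "set_integrable lborel (einterval (- \<infinity>) \<infinity>) g"
      using gi by (simp add: set_integrable_def)
    show "(((\<lambda>x. phi x * sin (t * x)) \<circ> real_of_ereal) \<longlongrightarrow> 0) (at_right (- \<infinity>))"
      unfolding ereal_tendsto_simps by (intro lim phi_tendsto_0)
    show "(((\<lambda>x. phi x * sin (t * x)) \<circ> real_of_ereal) \<longlongrightarrow> 0) (at_left \<infinity>)"
      unfolding ereal_tendsto_simps by (intro lim phi_tendsto_0)
  qed auto
  then have "(\<integral>x. g x \<partial>lborel) = 0"
    by (simp add: interval_lebesgue_integral_def set_lebesgue_integral_def)
  then have "t * (\<integral>x. phi x * cos (t * x) \<partial>lborel) - (\<integral>x. phi x * (x * sin (t * x)) \<partial>lborel) = 0"
    unfolding g_def using c i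
    by (subst (asm) Bochner_Integration.integral_diff) (auto dest: has_bochner_integral_iff[THEN iffD1])
  then show ?thesis
    using c i by (auto simp: has_bochner_integral_iff)
qed

text \<open>Completing the square: \<open>9 z\<^sup>2 + (y - z)\<^sup>2 = 10 (z - y / 10)\<^sup>2 + 9 y\<^sup>2 / 10\<close>.\<close>

lemma phi_mult_phi:
  "phi (3 * (y / 10 + x / sqrt 10)) * phi (y - (y / 10 + x / sqrt 10))
    = phi x * (exp (- (9 * y\<^sup>2 / 20)) / sqrt (2 * pi))"
proof -
  define u where "u = x / sqrt 10"
  have x: "x\<^sup>2 = 10 * u\<^sup>2" by (simp add: u_def power_divide)
  have "- ((3 * (y / 10 + u))\<^sup>2 / 2) + - ((y - (y / 10 + u))\<^sup>2 / 2) = - (x\<^sup>2 / 2) + - (9 * y\<^sup>2 / 20)"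
    unfolding x by (simp add: power2_eq_square field_simps)
  then have "exp (- ((3 * (y / 10 + u))\<^sup>2 / 2)) * exp (- ((y - (y / 10 + u))\<^sup>2 / 2))
      = exp (- (x\<^sup>2 / 2)) * exp (- (9 * y\<^sup>2 / 20))"
    by (simp only: mult_exp_exp)
  then show ?thesis
    by (simp add: normal_density_def u_def field_simps)
qed

text \<open>After the substitution \<open>z = y / 10 + x / sqrt 10\<close>,
  \<open>phi_mult_phi\<close> leaves the weight \<open>phi x\<close>, and the argument of the
  oscillation becomes a phase \<open>c\<close> plus \<open>t * x\<close>. The addition theorems
  reduce everything to the four preceding integrals. The damping is
  \<open>exp (- t\<^sup>2 / 2)\<close>, that is \<open>exp (- (k\<^sup>2 / 20))\<close>.\<close>

lemma has_bochner_integral_bump':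
  assumes k: "k > 0"
  shows "has_bochner_integral lborel (\<lambda>z. bump' k z * phi (y - z))
    (exp (- (9 * y\<^sup>2 / 20)) / sqrt (2 * pi) / (16 * sqrt 10) * exp (- (k\<^sup>2 / 20)) *
      (cos (k * y / 10) / 10 - 9 * (y * sin (k * y / 10) / k) / 10))"
proof -
  define c t E where "c = k * y / 10" and "t = k / sqrt 10" and "E = exp (- t\<^sup>2 / 2)"
  define K where "K = exp (- (9 * y\<^sup>2 / 20)) / sqrt (2 * pi) / 16"
  let ?T = "\<lambda>x. y / 10 + x / sqrt 10"
  have arg: "k * ?T x = c + t * x" for x
    by (simp add: c_def t_def field_simps)
  have eq: "bump' k (?T x) * phi (y - ?T x) =
      K * ((cos c - 9 * y / (10 * k) * sin c) * (phi x * cos (t * x))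
        + (- sin c - 9 * y / (10 * k) * cos c) * (phi x * sin (t * x))
        + (- 9 / (sqrt 10 * k) * sin c) * (phi x * (x * cos (t * x)))
        + (- 9 / (sqrt 10 * k) * cos c) * (phi x * (x * sin (t * x))))" for x
  proof -
    have "bump' k (?T x) * phi (y - ?T x) =
        (phi (3 * ?T x) * phi (y - ?T x)) * (cos (k * ?T x) - 9 * ?T x * (sin (k * ?T x) / k)) / 16"
      by (simp add: bump'_def)
    also have "\<dots> = K * (phi x * (cos (c + t * x) - 9 * ?T x * (sin (c + t * x) / k)))"
      unfolding phi_mult_phi arg by (simp add: K_def)
    also have "phi x * (cos (c + t * x) - 9 * ?T x * (sin (c + t * x) / k)) =
      (cos c - 9 * y / (10 * k) * sin c) * (phi x * cos (t * x))
        + (- sin c - 9 * y / (10 * k) * cos c) * (phi x * sin (t * x))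
        + (- 9 / (sqrt 10 * k) * sin c) * (phi x * (x * cos (t * x)))
        + (- 9 / (sqrt 10 * k) * cos c) * (phi x * (x * sin (t * x)))"
      using k unfolding cos_add sin_add by (simp add: field_simps)
    finally show ?thesis .
  qed
  have "has_bochner_integral lborel (\<lambda>x. bump' k (?T x) * phi (y - ?T x))
      (K * ((cos c - 9 * y / (10 * k) * sin c) * E
        + (- sin c - 9 * y / (10 * k) * cos c) * 0
        + (- 9 / (sqrt 10 * k) * sin c) * 0
        + (- 9 / (sqrt 10 * k) * cos c) * (t * E)))"
    unfolding eq E_def
    by (intro has_bochner_integral_mult_right has_bochner_integral_add impI
      has_bochner_integral_phi_cos has_bochner_integral_phi_sin
      has_bochner_integral_phi_id_cos has_bochner_integral_phi_id_sin)
  also have "(K * ((cos c - 9 * y / (10 * k) * sin c) * E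
        + (- sin c - 9 * y / (10 * k) * cos c) * 0
        + (- 9 / (sqrt 10 * k) * sin c) * 0
        + (- 9 / (sqrt 10 * k) * cos c) * (t * E)))
      = K * E * (cos c - 9 * y / (10 * k) * sin c - 9 / (sqrt 10 * k) * t * cos c)"
    by (simp add: algebra_simps)
  also have "9 / (sqrt 10 * k) * t = 9 / 10"
    using k by (simp add: t_def)
  finally have h: "has_bochner_integral lborel (\<lambda>x. bump' k (y / 10 + 1 / sqrt 10 * x) * phi (y - (y / 10 + 1 / sqrt 10 * x)))
      (K * E * (cos c - 9 * y / (10 * k) * sin c - 9 / 10 * cos c))" by simp
  \<comment> \<open>The factor \<open>1 / sqrt 10\<close> is the Jacobian of the
    substitution.\<close>
  define v where "v = K * E * (cos c - 9 * y / (10 * k) * sin c - 9 / 10 * cos c) / sqrt 10"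
  have "K * E * (cos c - 9 * y / (10 * k) * sin c - 9 / 10 * cos c) = v /\<^sub>R \<bar>1 / sqrt 10\<bar>"
    by (simp add: v_def)
  with h have "has_bochner_integral lborel (\<lambda>z. bump' k z * phi (y - z)) v"
    by (subst lborel_has_bochner_integral_real_affine_iff[of "1 / sqrt 10" _ _ "y / 10"]) auto
  moreover have "v = exp (- (9 * y\<^sup>2 / 20)) / sqrt (2 * pi) / (16 * sqrt 10) * exp (- (k\<^sup>2 / 20)) *
      (cos (k * y / 10) / 10 - 9 * (y * sin (k * y / 10) / k) / 10)"
    using k by (simp add: v_def K_def E_def c_def t_def power_divide field_simps)
  ultimately show ?thesis by simp
qed

section \<open>The law of a noisy observation\<close>

lemma distr_inv_density_lborel:
  fixes f f' p :: "real \<Rightarrow> real"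
  assumes bij: "bij f" and der: "\<And>x. (f has_real_derivative f' x) (at x)"
    and [measurable]: "inv f \<in> borel_measurable borel" "f' \<in> borel_measurable borel"
    and p: "integrable lborel p" and p0: "\<And>x. p x \<ge> 0"
  shows "distr (density lborel p) borel (inv f) = density lborel (\<lambda>x. \<bar>f' x\<bar> * p (f x))"
proof (rule measure_eqI)
  have [measurable]: "f \<in> borel_measurable borel"
    by (intro borel_measurable_continuous_onI DERIV_continuous_on)
      (rule has_field_derivative_at_within[OF der])
  have [measurable]: "p \<in> borel_measurable borel" using p by auto
  fix A assume "A \<in> sets (distr (density lborel p) borel (inv f))"
  then have [measurable]: "A \<in> sets borel" by simp
  have im: "inv f -` A = f ` A"
    using bij by (simp add: bij_vimage_eq_inv_image bij_imp_bij_inv inv_inv_eq)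
  have [measurable]: "f ` A \<in> sets borel"
    unfolding im[symmetric] using measurable_sets[of "inv f" borel borel A] by simp
  have emeasure_eq: "emeasure (density lborel q) S = ennreal (integral S q)"
    if "set_integrable lborel S q" "\<And>x. q x \<ge> 0" "S \<in> sets borel" "q \<in> borel_measurable borel" for q S
  proof -
    have "emeasure (density lborel q) S = (\<integral>\<^sup>+ x. ennreal (indicator S x * q x) \<partial>lborel)"
      using that by (subst emeasure_density) (auto intro!: nn_integral_cong split: split_indicator)
    also have "\<dots> = ennreal (LINT x:S|lborel. q x)"
      using that unfolding set_lebesgue_integral_def set_integrable_def
      by (subst nn_integral_eq_integral) auto
    finally show ?thesis
      using set_borel_integral_eq_integral(2)[OF that(1)] by simp
  qed
  have ip: "set_integrable lborel (f ` A) p"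
    using p unfolding set_integrable_def by (intro integrable_mult_indicator) auto
  \<comment> \<open>The change of variables theorem concerns the completed Lebesgue measure; for
    Borel measurable functions integrability there and over \<open>lborel\<close> agree, which
    allows passing back and forth.\<close>
  have "p absolutely_integrable_on (f ` A)"
    using ip unfolding set_integrable_def by (subst integrable_completion) auto
  then have iq: "(\<lambda>x. \<bar>f' x\<bar> * p (f x)) absolutely_integrable_on A"
    and eq: "integral A (\<lambda>x. \<bar>f' x\<bar> * p (f x)) = integral (f ` A) p"
    using has_absolute_integral_change_of_variables_1'[of A f f' p "integral (f ` A) p"]
      has_field_derivative_at_within[OF der] bij
    by (auto simp: bij_def intro: inj_on_subset)
  have "set_integrable lborel A (\<lambda>x. \<bar>f' x\<bar> * p (f x))"
    using iq unfolding set_integrable_def by (subst (asm) integrable_completion) auto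
  then have "emeasure (density lborel (\<lambda>x. \<bar>f' x\<bar> * p (f x))) A = emeasure (density lborel p) (f ` A)"
    using ip p0 eq by (subst (1 2) emeasure_eq) auto
  then show "emeasure (distr (density lborel p) borel (inv f)) A =
      emeasure (density lborel (\<lambda>x. ennreal (\<bar>f' x\<bar> * p (f x)))) A"
    by (subst emeasure_distr) (auto simp: im)
qed simp

text \<open>A lower bound, under both decoders, for the density of \<open>y 1\<close>; it is negative far out, where
  \<open>ennreal\<close> truncates it to \<open>0\<close>.\<close>

definition common_density :: "real \<Rightarrow> real \<Rightarrow> real" where
  "common_density k y =
    normal_density 0 (sqrt (5 / 4)) y - exp (- (k\<^sup>2 / 20)) / 16 * normal_density 0 (sqrt (5 / 2)) y"

lemma measurable_common_density [measurable]: "common_density k \<in> borel_measurable borel"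
  unfolding common_density_def by measurable

text \<open>The linear growth of the bracket is paid for with \<open>exp (y\<^sup>2 / 4)\<close>.
  The remaining Gaussian \<open>exp (- (y\<^sup>2 / 5))\<close> belongs to variance 5/2, so the
  error is a small multiple of a probability density and its total mass is known.\<close>

lemma smoothed_bump'_bound:
  assumes k: "k \<ge> 1"
  shows "\<bar>\<integral>z. bump' k z * phi (y - z) \<partial>lborel\<bar> \<le> exp (- (k\<^sup>2 / 20)) / 16 * normal_density 0 (sqrt (5 / 2)) y"
proof -
  let ?b = "cos (k * y / 10) / 10 - 9 * (y * sin (k * y / 10) / k) / 10"
  have "\<bar>y * sin (k * y / 10) / k\<bar> \<le> \<bar>y\<bar>"
  proof -
    have "\<bar>y\<bar> * \<bar>sin (k * y / 10)\<bar> \<le> \<bar>y\<bar> * k"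
      by (intro mult_left_mono order_trans[OF abs_sin_le_one k]) auto
    then show ?thesis using k by (simp add: abs_mult field_simps)
  qed
  then have "\<bar>?b\<bar> \<le> 1 + \<bar>y\<bar>"
    using abs_cos_le_one[of "k * y / 10"] unfolding abs_le_iff by argo
  also have "\<dots> \<le> 2 * (1 + y\<^sup>2 / 4)"
    using zero_le_power2[of "\<bar>y\<bar> - 1"] by (simp add: power2_diff)
  also have "\<dots> \<le> 2 * exp (y\<^sup>2 / 4)"
    by (intro mult_left_mono exp_ge_add_one_self) auto
  finally have b: "\<bar>?b\<bar> \<le> 2 * exp (y\<^sup>2 / 4)" .
  have "k > 0" using k by simp
  from has_bochner_integral_bump'[OF this, of y]
  have "\<bar>\<integral>z. bump' k z * phi (y - z) \<partial>lborel\<bar> =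
      exp (- (9 * y\<^sup>2 / 20)) / sqrt (2 * pi) / (16 * sqrt 10) * exp (- (k\<^sup>2 / 20)) * \<bar>?b\<bar>"
    by (simp add: has_bochner_integral_iff abs_mult)
  also have "\<dots> \<le> exp (- (9 * y\<^sup>2 / 20)) / sqrt (2 * pi) / (16 * sqrt 10) * exp (- (k\<^sup>2 / 20)) * (2 * exp (y\<^sup>2 / 4))"
    by (intro mult_left_mono b) auto
  also have "\<dots> = exp (- (k\<^sup>2 / 20)) / 16 * (2 / (sqrt (2 * pi) * sqrt 10) * (exp (- (9 * y\<^sup>2 / 20)) * exp (y\<^sup>2 / 4)))"
    by (simp add: field_simps)
  also have "exp (- (9 * y\<^sup>2 / 20)) * exp (y\<^sup>2 / 4) = exp (- (y\<^sup>2 / 5))"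
    by (simp add: mult_exp_exp)
  also have "2 / (sqrt (2 * pi) * sqrt 10) * exp (- (y\<^sup>2 / 5)) = normal_density 0 (sqrt (5 / 2)) y"
  proof -
    have "sqrt (2 * pi) * sqrt 10 = sqrt 4 * sqrt (5 * pi)"
      unfolding real_sqrt_mult[symmetric] by simp
    then show ?thesis by (simp add: normal_density_def)
  qed
  finally show ?thesis .
qed

text \<open>The integral is the density at \<open>y\<close> of the latent observation plus output
  noise. Its unperturbed part is the convolution of normal laws of variances 1/4 and 1, hence of
  variance 5/4; the part carrying \<open>s\<close> is bounded by
  \<open>smoothed_bump'_bound\<close>.\<close>

lemma observation_density_ge:
  assumes k: "k \<ge> 1" and s: "\<bar>s\<bar> \<le> 1"
  shows "ennreal (common_density k y)
    \<le> (\<integral>\<^sup>+ z. ennreal ((2 * phi (2 * z) + s * bump' k z) * phi (y - z)) \<partial>lborel)"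
proof -
  have two: "2 * phi (2 * z) = normal_density 0 (1 / 2) z" for z
  proof -
    have "sqrt (2 * pi) = sqrt 4 * sqrt (2 * pi * (1 / 2)\<^sup>2)"
      unfolding real_sqrt_mult[symmetric] by (simp add: power2_eq_square)
    then show ?thesis by (simp add: normal_density_def power2_eq_square)
  qed
  have "(\<integral>\<^sup>+ z. ennreal (phi (y - z) * normal_density 0 (1 / 2) z) \<partial>lborel)
      = normal_density 0 (sqrt (5 / 4)) y"
    using fun_cong[OF conv_normal_density_zero_mean[of 1 "1 / 2"], of y] by (simp add: power2_eq_square)
  then have p: "has_bochner_integral lborel (\<lambda>z. phi (y - z) * normal_density 0 (1 / 2) z) (normal_density 0 (sqrt (5 / 4)) y)"
    by (intro has_bochner_integral_nn_integral) auto
  define r where "r = (\<integral>z. bump' k z * phi (y - z) \<partial>lborel)"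
  have "k > 0" using k by simp
  from has_bochner_integral_bump'[OF this, of y]
  have r: "has_bochner_integral lborel (\<lambda>z. bump' k z * phi (y - z)) r"
    by (simp add: r_def has_bochner_integral_iff)
  have "has_bochner_integral lborel (\<lambda>z. phi (y - z) * normal_density 0 (1 / 2) z + s * (bump' k z * phi (y - z)))
      (normal_density 0 (sqrt (5 / 4)) y + s * r)"
    by (intro has_bochner_integral_add has_bochner_integral_mult_right p r impI)
  also have "(\<lambda>z. phi (y - z) * normal_density 0 (1 / 2) z + s * (bump' k z * phi (y - z)))
      = (\<lambda>z. (2 * phi (2 * z) + s * bump' k z) * phi (y - z))"
    unfolding two[symmetric] by (simp add: algebra_simps)
  finally have i: "has_bochner_integral lborel (\<lambda>z. (2 * phi (2 * z) + s * bump' k z) * phi (y - z))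
     (normal_density 0 (sqrt (5 / 4)) y + s * r)" .
  have nn: "0 \<le> (2 * phi (2 * z) + s * bump' k z) * phi (y - z)" for z
  proof (rule mult_nonneg_nonneg)
    show "0 \<le> 2 * phi (2 * z) + s * bump' k z"
      using latent_density_bounds(1)[OF \<open>k > 0\<close> s, of z] phi_pos[of "2 * z"] by linarith
  qed simp
  have "(\<integral>\<^sup>+ z. ennreal ((2 * phi (2 * z) + s * bump' k z) * phi (y - z)) \<partial>lborel)
      = ennreal (normal_density 0 (sqrt (5 / 4)) y + s * r)"
    using i nn by (subst nn_integral_eq_integral) (auto simp: has_bochner_integral_iff)
  moreover have "\<bar>s * r\<bar> \<le> 1 * (exp (- (k\<^sup>2 / 20)) / 16 * normal_density 0 (sqrt (5 / 2)) y)"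
    unfolding abs_mult r_def by (intro mult_mono s smoothed_bump'_bound k) auto
  then have "common_density k y \<le> normal_density 0 (sqrt (5 / 4)) y + s * r"
    by (simp add: common_density_def abs_le_iff)
  ultimately show ?thesis by (simp add: ennreal_leI)
qed

section \<open>Comparison of the observation law with the common density\<close>

lemma measurable_inv_decoder:
  assumes "k > 0" "\<bar>s\<bar> \<le> 1"
  shows "inv (decoder k s) \<in> borel_measurable borel"
proof (rule borel_measurable_mono, rule monoI)
  fix x y :: real assume "x \<le> y"
  moreover have "decoder k s (inv (decoder k s) w) = w" for w
    using bij_decoder[OF assms] by (simp add: bij_is_surj surj_f_inv_f)
  ultimately show "inv (decoder k s) x \<le> inv (decoder k s) y"
    using strict_mono_less_eq[OF strict_mono_decoder[OF assms]] by metis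
qed

text \<open>Here the definition through \<open>Phi\<close> pays off: the denominator
  \<open>phi (decoder k s z)\<close> of the derivative cancels against the normal density of the
  state.\<close>

lemma distr_inv_decoder:
  assumes k: "k > 0" and s: "\<bar>s\<bar> \<le> 1"
  shows "distr N01 borel (inv (decoder k s))
    = density lborel (\<lambda>z. 2 * phi (2 * z) + s * bump' k z)"
proof -
  have [measurable]: "decoder k s \<in> borel_measurable borel"
    by (rule borel_measurable_continuous_onI[OF continuous_on_decoder[OF assms]])
  have nn: "0 \<le> 2 * phi (2 * z) + s * bump' k z" for z
    using latent_density_bounds(1)[OF k s, of z] phi_pos[of "2 * z"] by linarith
  have "distr N01 borel (inv (decoder k s)) =
    density lborel (\<lambda>z. \<bar>(2 * phi (2 * z) + s * bump' k z) / phi (decoder k s z)\<bar> * phi (decoder k s z))"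
    using measurable_inv_decoder[OF assms]
    by (intro distr_inv_density_lborel bij_decoder DERIV_decoder assms)
      (auto intro: less_imp_le)
  also have "(\<lambda>z. \<bar>(2 * phi (2 * z) + s * bump' k z) / phi (decoder k s z)\<bar> * phi (decoder k s z))
      = (\<lambda>z. 2 * phi (2 * z) + s * bump' k z)"
    using nn by (auto simp: fun_eq_iff abs_mult less_imp_neq[symmetric])
  finally show ?thesis .
qed

text \<open>Domination of measures is expressed through nonnegative test functions, the form that
  can be iterated over coordinates and trajectories. The proof writes the law of the sum as a
  convolution, by Fubini and a translation.\<close>

lemma nn_integral_observation_ge:
  assumes k: "k \<ge> 1" and s: "\<bar>s\<bar> \<le> 1" and [measurable]: "h \<in> borel_measurable borel"
  shows "(\<integral>\<^sup>+ y. ennreal (common_density k y) * h y \<partial>lborel)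
    \<le> (\<integral>\<^sup>+ w. \<integral>\<^sup>+ e. h (inv (decoder k s) w + e) \<partial>N01 \<partial>N01)"
proof -
  interpret N: prob_space N01 by (rule prob_space_N01)
  have k0: "k > 0" using k by simp
  note [measurable] = measurable_inv_decoder[OF k0 s]
  have nn: "0 \<le> 2 * phi (2 * z) + s * bump' k z" for z
    using latent_density_bounds(1)[OF k0 s, of z] phi_pos[of "2 * z"] by linarith
  have "(\<integral>\<^sup>+ y. ennreal (common_density k y) * h y \<partial>lborel)
      \<le> (\<integral>\<^sup>+ y. (\<integral>\<^sup>+ z. ennreal ((2 * phi (2 * z) + s * bump' k z) * phi (y - z)) \<partial>lborel) * h y \<partial>lborel)"
    by (intro nn_integral_mono mult_right_mono observation_density_ge k s) auto
  also have "\<dots> = (\<integral>\<^sup>+ y. \<integral>\<^sup>+ z. ennreal ((2 * phi (2 * z) + s * bump' k z) * phi (y - z)) * h y \<partial>lborel \<partial>lborel)"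
    by (intro nn_integral_cong nn_integral_multc[symmetric]) measurable
  also have "\<dots> = (\<integral>\<^sup>+ z. \<integral>\<^sup>+ y. ennreal ((2 * phi (2 * z) + s * bump' k z) * phi (y - z)) * h y \<partial>lborel \<partial>lborel)"
    by (rule lborel_pair.Fubini'[symmetric]) measurable
  also have "\<dots> = (\<integral>\<^sup>+ z. ennreal (2 * phi (2 * z) + s * bump' k z) * (\<integral>\<^sup>+ y. ennreal (phi (y - z)) * h y \<partial>lborel) \<partial>lborel)"
    using nn by (intro nn_integral_cong, subst nn_integral_cmult[symmetric])
      (auto simp: ennreal_mult mult.assoc less_imp_le intro!: nn_integral_cong)
  also have "\<dots> = (\<integral>\<^sup>+ z. ennreal (2 * phi (2 * z) + s * bump' k z) * (\<integral>\<^sup>+ e. h (z + e) \<partial>N01) \<partial>lborel)"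
  proof (intro nn_integral_cong arg_cong2[where f="(*)"] refl)
    fix z :: real
    have "(\<integral>\<^sup>+ y. ennreal (phi (y - z)) * h y \<partial>lborel) = (\<integral>\<^sup>+ e. ennreal (phi e) * h (z + e) \<partial>lborel)"
      by (subst nn_integral_real_affine[where c=1 and t=z]) auto
    then show "(\<integral>\<^sup>+ y. ennreal (phi (y - z)) * h y \<partial>lborel) = (\<integral>\<^sup>+ e. h (z + e) \<partial>N01)"
      by (subst nn_integral_density) auto
  qed
  also have "\<dots> = (\<integral>\<^sup>+ z. \<integral>\<^sup>+ e. h (z + e) \<partial>N01 \<partial>distr N01 borel (inv (decoder k s)))"
    unfolding distr_inv_decoder[OF k0 s] by (rule nn_integral_density[symmetric]) measurable
  also have "\<dots> = (\<integral>\<^sup>+ w. \<integral>\<^sup>+ e. h (inv (decoder k s) w + e) \<partial>N01 \<partial>N01)"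
  proof -
    have "(\<lambda>z. \<integral>\<^sup>+ e. h (z + e) \<partial>N01) \<in> borel_measurable borel"
      by (rule N.borel_measurable_nn_integral) measurable
    then show ?thesis by (intro nn_integral_distr) auto
  qed
  finally show ?thesis .
qed

lemma nn_integral_common_density_ge:
  "ennreal (1 - exp (- (k\<^sup>2 / 20)) / 16) \<le> (\<integral>\<^sup>+ y. ennreal (common_density k y) \<partial>lborel)"
proof -
  define d where "d = exp (- (k\<^sup>2 / 20)) / 16"
  have d: "d \<ge> 0" by (simp add: d_def)
  have mass: "(\<integral>\<^sup>+ y. ennreal (normal_density 0 v y) \<partial>lborel) = 1" if "v > 0" for v
    using prob_space.emeasure_space_1[OF prob_space_normal_density[OF that, of 0]]
    by (simp add: emeasure_density)
  have "(1::ennreal) = (\<integral>\<^sup>+ y. ennreal (normal_density 0 (sqrt (5 / 4)) y) \<partial>lborel)"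
    by (simp add: mass)
  also have "\<dots> \<le> (\<integral>\<^sup>+ y. ennreal (common_density k y) + ennreal (d * normal_density 0 (sqrt (5 / 2)) y) \<partial>lborel)"
  proof (intro nn_integral_mono)
    fix y
    have "ennreal (normal_density 0 (sqrt (5 / 4)) y) = ennreal (common_density k y + d * normal_density 0 (sqrt (5 / 2)) y)"
      by (simp add: common_density_def d_def)
    \<comment> \<open>Truncation at 0 is subadditive, so the inequality survives where
      \<open>common_density\<close> is negative.\<close>
    also have "\<dots> \<le> ennreal (common_density k y) + ennreal (d * normal_density 0 (sqrt (5 / 2)) y)"
      by (cases "common_density k y \<ge> 0")
        (auto simp: d_def ennreal_plus ennreal_neg intro!: ennreal_leI add_nonneg_nonneg)
    finally show "ennreal (normal_density 0 (sqrt (5 / 4)) y) \<le> \<dots>" .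
  qed
  also have "\<dots> = (\<integral>\<^sup>+ y. ennreal (common_density k y) \<partial>lborel) + ennreal d"
    using d by (subst nn_integral_add) (auto simp: ennreal_mult nn_integral_cmult mass)
  finally have "ennreal 1 - ennreal d \<le> (\<integral>\<^sup>+ y. ennreal (common_density k y) \<partial>lborel)"
    by (simp add: ennreal_minus_le_iff add.commute)
  then show ?thesis
    by (subst (asm) ennreal_minus) (auto simp: d_def)
qed

text \<open>The main term is at least 3/20 on [0, 1] and the error term at most 1/48, for every
  \<open>k\<close>.\<close>

lemma common_density_ge:
  assumes "0 \<le> y" "y \<le> 1"
  shows "1 / 10 \<le> common_density k y"
proof -
  have "sqrt (2 * pi * (sqrt (5 / 4))\<^sup>2) \<le> 4"
    using pi_less_4 by (intro real_le_lsqrt) auto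
  moreover have "y\<^sup>2 \<le> 1" using assms by (simp add: power_le_one)
  then have "exp (- (y\<^sup>2 / (2 * (sqrt (5 / 4))\<^sup>2))) \<ge> 3 / 5"
    using exp_ge_add_one_self[of "- (y\<^sup>2 / (2 * (sqrt (5 / 4))\<^sup>2))"] by simp
  ultimately have "(1 / 4) * (3 / 5) \<le> 1 / sqrt (2 * pi * (sqrt (5 / 4))\<^sup>2) * exp (- (y\<^sup>2 / (2 * (sqrt (5 / 4))\<^sup>2)))"
    by (intro mult_mono) (auto simp: field_simps)
  then have p: "normal_density 0 (sqrt (5 / 4)) y \<ge> 3 / 20"
    by (simp add: normal_density_def)
  have "3 \<le> sqrt (2 * pi * (sqrt (5 / 2))\<^sup>2)"
    using pi_ge_two by (intro real_le_rsqrt) auto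
  then have "1 / sqrt (2 * pi * (sqrt (5 / 2))\<^sup>2) * exp (- (y\<^sup>2 / (2 * (sqrt (5 / 2))\<^sup>2))) \<le> 1 / 3 * 1"
    by (intro mult_mono) (auto simp: field_simps)
  then have "normal_density 0 (sqrt (5 / 2)) y \<le> 1 / 3"
    by (simp add: normal_density_def)
  then have "exp (- (k\<^sup>2 / 20)) / 16 * normal_density 0 (sqrt (5 / 2)) y \<le> 1 / 16 * (1 / 3)"
    by (intro mult_mono) auto
  with p show ?thesis unfolding common_density_def by linarith
qed

section \<open>The law of the data\<close>

text \<open>Domination by a pushforward tensorizes: the coordinates are replaced one at a time, the
  inserted one by \<open>step\<close> and the others by the induction hypothesis.\<close>

lemma nn_integral_PiM_pushforward_ge:
  fixes N :: "'a measure" and M :: "'b measure"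
  assumes N: "sigma_finite_measure N" and M: "sigma_finite_measure M" and "finite I"
    and g [measurable]: "g \<in> measurable N M"
    and step: "\<And>h. h \<in> borel_measurable M \<Longrightarrow> (\<integral>\<^sup>+ y. h y \<partial>M) \<le> (\<integral>\<^sup>+ x. h (g x) \<partial>N)"
    and "h \<in> borel_measurable (Pi\<^sub>M I (\<lambda>_. M))"
  shows "(\<integral>\<^sup>+ y. h y \<partial>Pi\<^sub>M I (\<lambda>_. M)) \<le> (\<integral>\<^sup>+ x. h (\<lambda>i\<in>I. g (x i)) \<partial>Pi\<^sub>M I (\<lambda>_. N))"
  using \<open>finite I\<close> \<open>h \<in> _\<close>
proof (induction I arbitrary: h rule: finite_induct)
  case empty
  then show ?case by (simp add: PiM_empty nn_integral_count_space_finite)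
next
  case (insert i I)
  interpret N: sigma_finite_measure N by fact
  interpret M: sigma_finite_measure M by fact
  interpret NN: product_sigma_finite "\<lambda>_. N" by standard
  interpret MM: product_sigma_finite "\<lambda>_. M" by standard
  note [measurable] = insert.prems
  have [measurable]: "(\<lambda>x. h (\<lambda>j\<in>insert i I. g (x j))) \<in> borel_measurable (Pi\<^sub>M (insert i I) (\<lambda>_. N))"
    by measurable
  have [measurable]: "(\<lambda>(x, y). h (x(i := y))) \<in> borel_measurable (Pi\<^sub>M I (\<lambda>_. M) \<Otimes>\<^sub>M M)"
    using measurable_compose[OF measurable_add_dim insert.prems]
    by (simp add: case_prod_unfold)
  have "(\<integral>\<^sup>+ y. h y \<partial>Pi\<^sub>M (insert i I) (\<lambda>_. M)) = (\<integral>\<^sup>+ x. \<integral>\<^sup>+ y. h (x(i := y)) \<partial>M \<partial>Pi\<^sub>M I (\<lambda>_. M))"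
    using insert by (subst MM.product_nn_integral_insert) auto
  also have "\<dots> \<le> (\<integral>\<^sup>+ x. \<integral>\<^sup>+ y. h (x(i := g y)) \<partial>N \<partial>Pi\<^sub>M I (\<lambda>_. M))"
    by (intro nn_integral_mono step) measurable
  also have "\<dots> \<le> (\<integral>\<^sup>+ x. \<integral>\<^sup>+ y. h ((\<lambda>j\<in>I. g (x j))(i := g y)) \<partial>N \<partial>Pi\<^sub>M I (\<lambda>_. N))"
    by (intro insert.IH N.borel_measurable_nn_integral) measurable
  also have "\<dots> = (\<integral>\<^sup>+ x. \<integral>\<^sup>+ y. h (\<lambda>j\<in>insert i I. g ((x(i := y)) j)) \<partial>N \<partial>Pi\<^sub>M I (\<lambda>_. N))"
    using insert.hyps
    by (intro nn_integral_cong arg_cong[of _ _ h]) (auto simp: fun_eq_iff)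
  also have "\<dots> = (\<integral>\<^sup>+ x. h (\<lambda>j\<in>insert i I. g (x j)) \<partial>Pi\<^sub>M (insert i I) (\<lambda>_. N))"
    using insert.hyps by (subst NN.product_nn_integral_insert) auto
  finally show ?case .
qed

section \<open>Noise integrals and records of the uncontrolled system\<close>

declare One_nat_def [simp del]

text \<open>Fubini separates the two noise sequences; the state noise then enters only through its
  coordinate 0 and is replaced by that marginal law.\<close>

lemma nn_integral_noise_1:
  fixes h :: "real \<Rightarrow> real \<Rightarrow> real \<Rightarrow> ennreal"
  assumes [measurable]: "(\<lambda>(w, a, e). h w a e) \<in> borel_measurable (borel \<Otimes>\<^sub>M borel \<Otimes>\<^sub>M borel)"
  shows "(\<integral>\<^sup>+ \<omega>. h (fst \<omega> 0) (snd \<omega> 0) (snd \<omega> 1) \<partial>noise 1)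
    = (\<integral>\<^sup>+ w. \<integral>\<^sup>+ a. \<integral>\<^sup>+ e. h w a e \<partial>N01 \<partial>N01 \<partial>N01)"
proof -
  interpret N: prob_space N01 by (rule prob_space_N01)
  interpret NN: product_prob_space "\<lambda>_::nat. N01" "{..1}" by standard
  have two: "{..1} = {0, 1::nat}" by auto
  let ?P = "Pi\<^sub>M {..1::nat} (\<lambda>_. N01)"
  have "(\<lambda>\<omega>. (fst \<omega> 0, snd \<omega> 0, snd \<omega> 1)) \<in> measurable (?P \<Otimes>\<^sub>M ?P) (borel \<Otimes>\<^sub>M borel \<Otimes>\<^sub>M borel)"
    by measurable
  from measurable_compose[OF this assms]
  have hm: "(\<lambda>\<omega>. h (fst \<omega> 0) (snd \<omega> 0) (snd \<omega> 1)) \<in> borel_measurable (?P \<Otimes>\<^sub>M ?P)"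
    by simp
  have "(\<integral>\<^sup>+ \<omega>. h (fst \<omega> 0) (snd \<omega> 0) (snd \<omega> 1) \<partial>noise 1)
      = (\<integral>\<^sup>+ \<omega>. \<integral>\<^sup>+ \<eta>. h (\<omega> 0) (\<eta> 0) (\<eta> 1) \<partial>?P \<partial>?P)"
    unfolding noise_def using hm
    by (subst sigma_finite_measure.nn_integral_fst[OF prob_space_imp_sigma_finite[OF NN.prob_space_axioms], symmetric]) auto
  also have "\<dots> = (\<integral>\<^sup>+ \<omega>. \<integral>\<^sup>+ a. \<integral>\<^sup>+ e. h (\<omega> 0) a e \<partial>N01 \<partial>N01 \<partial>?P)"
  proof (rule nn_integral_cong)
    fix \<omega> :: "nat \<Rightarrow> real"
    have "(\<lambda>(a, e). (\<omega> 0, a, e)) \<in> measurable (N01 \<Otimes>\<^sub>M N01) (borel \<Otimes>\<^sub>M borel \<Otimes>\<^sub>M borel)"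
      by measurable
    from measurable_compose[OF this assms]
    have sections: "(\<lambda>(a, e). h (\<omega> 0) a e) \<in> borel_measurable (N01 \<Otimes>\<^sub>M N01)"
      by (simp add: split_def)
    have "(\<integral>\<^sup>+ \<eta>. h (\<omega> 0) (\<eta> 0) (\<eta> 1) \<partial>?P) = (\<integral>\<^sup>+ z. h (\<omega> 0) (fst z) (snd z) \<partial>(N01 \<Otimes>\<^sub>M N01))"
      unfolding two using sections by (intro NN.product_nn_integral_pair) auto
    also have "\<dots> = (\<integral>\<^sup>+ a. \<integral>\<^sup>+ e. h (\<omega> 0) a e \<partial>N01 \<partial>N01)"
      using N.nn_integral_fst[of "\<lambda>z. h (\<omega> 0) (fst z) (snd z)" N01] sections by (simp add: split_def)
    finally show "(\<integral>\<^sup>+ \<eta>. h (\<omega> 0) (\<eta> 0) (\<eta> 1) \<partial>?P) = \<dots>" .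
  qed
  also have "\<dots> = (\<integral>\<^sup>+ w. \<integral>\<^sup>+ a. \<integral>\<^sup>+ e. h w a e \<partial>N01 \<partial>N01 \<partial>distr ?P N01 (\<lambda>\<omega>. \<omega> 0))"
  proof -
    have "(\<lambda>p. (fst (fst p), snd (fst p), snd p)) \<in> measurable ((N01 \<Otimes>\<^sub>M N01) \<Otimes>\<^sub>M N01) (borel \<Otimes>\<^sub>M borel \<Otimes>\<^sub>M borel)"
      by measurable
    from measurable_compose[OF this assms]
    have [measurable]: "(\<lambda>p. h (fst (fst p)) (snd (fst p)) (snd p)) \<in> borel_measurable ((N01 \<Otimes>\<^sub>M N01) \<Otimes>\<^sub>M N01)"
      by simp
    have "(\<lambda>w. \<integral>\<^sup>+ a. \<integral>\<^sup>+ e. h w a e \<partial>N01 \<partial>N01) \<in> borel_measurable N01"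
      by (intro N.borel_measurable_nn_integral) (simp add: split_def)
    then show ?thesis by (subst nn_integral_distr) auto
  qed
  also have "distr ?P N01 (\<lambda>\<omega>. \<omega> 0) = N01"
    by (rule NN.PiM_component) simp
  finally show ?thesis .
qed

text \<open>The value \<open>undefined\<close> outside {0, 1} matches the extensional records
  produced by \<open>rollout\<close>.\<close>

definition obs_record :: "real \<Rightarrow> real \<Rightarrow> obs_seq" where
  "obs_record a y = (\<lambda>_. undefined)(0 := a, 1 := y)"

lemma obs_record_1 [simp]: "obs_record a y 1 = y"
  by (simp add: obs_record_def)

lemma measurable_obs_record [measurable]:
  assumes [measurable]: "u \<in> borel_measurable M" "v \<in> borel_measurable M"
  shows "(\<lambda>x. obs_record (u x) (v x)) \<in> measurable M (Pi\<^sub>M {..1} (\<lambda>_. borel))"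
proof (rule measurable_PiM_single')
  have "{..1::nat} = {0, 1}" by auto
  then show "(\<lambda>x. obs_record (u x) (v x)) \<in> space M \<rightarrow> (\<Pi>\<^sub>E i\<in>{..1}. space borel)"
    by (auto simp: obs_record_def PiE_def extensional_def)
  fix i :: nat assume "i \<in> {..1}"
  then have "i = 0 \<or> i = 1" by auto
  then show "(\<lambda>x. obs_record (u x) (v x) i) \<in> borel_measurable M"
    by (auto simp: obs_record_def)
qed

text \<open>With \<open>A = B = 0\<close> the state at time 1 is the noise \<open>w 0\<close>, so
  the right-hand side is free of \<open>g\<close>: adaptive inputs cannot change the data.\<close>

lemma observations_uncontrolled:
  "observations f 0 0 0 g \<omega> 1 = obs_record (inv f 0 + snd \<omega> 0) (inv f (fst \<omega> 0) + snd \<omega> 1)"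
  by (simp add: observations_def obs_record_def One_nat_def Let_def)

lemma collected_data_uncontrolled:
  "collected_data f 0 0 0 1 a \<omega> n =
    (\<lambda>i\<in>{..<n}. obs_record (inv f 0 + snd (\<omega> i) 0) (inv f (fst (\<omega> i) 0) + snd (\<omega> i) 1))"
  by (induction n)
    (auto simp: Let_def observations_uncontrolled restrict_def fun_eq_iff less_Suc_eq)

section \<open>The common part of the laws of a record under both decoders\<close>

definition common_law :: "real \<Rightarrow> obs_seq measure" where
  "common_law k = distr (N01 \<Otimes>\<^sub>M density lborel (common_density k)) (Pi\<^sub>M {..1} (\<lambda>_. borel))
    (\<lambda>(a, y). obs_record a y)"

lemma sets_common_law [measurable_cong, simp]: "sets (common_law k) = sets (Pi\<^sub>M {..1} (\<lambda>_. borel))"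
  by (simp add: common_law_def)

lemma finite_measure_common: "finite_measure (density lborel (common_density k))"
proof (rule finite_measureI)
  have "(\<integral>\<^sup>+ y. ennreal (common_density k y) \<partial>lborel)
      \<le> (\<integral>\<^sup>+ y. ennreal (normal_density 0 (sqrt (5 / 4)) y) \<partial>lborel)"
    by (intro nn_integral_mono ennreal_leI) (simp add: common_density_def)
  also have "\<dots> = 1"
    using prob_space.emeasure_space_1[OF prob_space_normal_density[of "sqrt (5 / 4)" 0]]
    by (simp add: emeasure_density)
  finally show "emeasure (density lborel (common_density k)) (space (density lborel (common_density k))) \<noteq> \<infinity>"
    by (auto simp: emeasure_density top_unique)
qed

lemma nn_integral_common_law:
  assumes [measurable]: "h \<in> borel_measurable (Pi\<^sub>M {..1} (\<lambda>_. borel))"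
  shows "(\<integral>\<^sup>+ Y. h Y \<partial>common_law k)
    = (\<integral>\<^sup>+ a. \<integral>\<^sup>+ y. ennreal (common_density k y) * h (obs_record a y) \<partial>lborel \<partial>N01)"
proof -
  interpret F: finite_measure "density lborel (common_density k)" by (rule finite_measure_common)
  have "(\<integral>\<^sup>+ Y. h Y \<partial>common_law k)
      = (\<integral>\<^sup>+ z. h (obs_record (fst z) (snd z)) \<partial>(N01 \<Otimes>\<^sub>M density lborel (common_density k)))"
    unfolding common_law_def split_def by (rule nn_integral_distr) measurable
  also have "\<dots> = (\<integral>\<^sup>+ a. \<integral>\<^sup>+ y. h (obs_record a y) \<partial>density lborel (common_density k) \<partial>N01)"
    using F.nn_integral_fst[of "\<lambda>z. h (obs_record (fst z) (snd z))" N01] by simp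
  also have "\<dots> = (\<integral>\<^sup>+ a. \<integral>\<^sup>+ y. ennreal (common_density k y) * h (obs_record a y) \<partial>lborel \<partial>N01)"
    by (intro nn_integral_cong nn_integral_density) measurable
  finally show ?thesis .
qed

lemma finite_measure_common_law: "finite_measure (common_law k)"
proof -
  interpret N: prob_space N01 by (rule prob_space_N01)
  interpret F: finite_measure "density lborel (common_density k)" by (rule finite_measure_common)
  have "finite_measure (N01 \<Otimes>\<^sub>M density lborel (common_density k))"
    by (rule finite_measure_pair_measure) unfold_locales
  then show ?thesis
    unfolding common_law_def by (rule finite_measure.finite_measure_distr) measurable
qed

lemma emeasure_common_law_ge:
  "ennreal (1 - exp (- (k\<^sup>2 / 20)) / 16) \<le> emeasure (common_law k) (space (common_law k))"
proof -
  interpret N: prob_space N01 by (rule prob_space_N01)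
  have "emeasure (common_law k) (space (common_law k)) = (\<integral>\<^sup>+ Y. 1 \<partial>common_law k)" by simp
  also have "\<dots> = (\<integral>\<^sup>+ y. ennreal (common_density k y) \<partial>lborel)"
    using N.emeasure_space_1 by (subst nn_integral_common_law) auto
  finally show ?thesis using nn_integral_common_density_ge by simp
qed

text \<open>The left-hand side is free of \<open>s\<close>, so one measure of mass at most 1 lies
  below the law of a record under either decoder. The time-0 observation is independent noise and
  only the time-1 coordinate loses mass.\<close>

lemma nn_integral_records_ge:
  assumes k: "k \<ge> 1" and s: "\<bar>s\<bar> \<le> 1"
    and [measurable]: "h \<in> borel_measurable (Pi\<^sub>M {..1} (\<lambda>_. borel))"
  shows "(\<integral>\<^sup>+ Y. h Y \<partial>common_law k)
    \<le> (\<integral>\<^sup>+ \<omega>. h (obs_record (snd \<omega> 0) (inv (decoder k s) (fst \<omega> 0) + snd \<omega> 1)) \<partial>noise 1)"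
proof -
  interpret N: prob_space N01 by (rule prob_space_N01)
  interpret pair_sigma_finite N01 N01 ..
  have k0: "k > 0" using k by simp
  note [measurable] = measurable_inv_decoder[OF k0 s]
  have "(\<integral>\<^sup>+ Y. h Y \<partial>common_law k)
      \<le> (\<integral>\<^sup>+ a. \<integral>\<^sup>+ w. \<integral>\<^sup>+ e. h (obs_record a (inv (decoder k s) w + e)) \<partial>N01 \<partial>N01 \<partial>N01)"
    by (subst nn_integral_common_law) (auto intro!: nn_integral_mono nn_integral_observation_ge k s)
  also have "\<dots> = (\<integral>\<^sup>+ w. \<integral>\<^sup>+ a. \<integral>\<^sup>+ e. h (obs_record a (inv (decoder k s) w + e)) \<partial>N01 \<partial>N01 \<partial>N01)"
    by (rule Fubini') (unfold split_def, rule N.borel_measurable_nn_integral, measurable)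
  also have "\<dots> = (\<integral>\<^sup>+ \<omega>. h (obs_record (snd \<omega> 0) (inv (decoder k s) (fst \<omega> 0) + snd \<omega> 1)) \<partial>noise 1)"
    by (rule nn_integral_noise_1[symmetric]) measurable
  finally show ?thesis .
qed

text \<open>The domination is used twice: for the test trajectory (\<open>test\<close>) and, through
  the product lemma, for the \<open>n\<close> training trajectories (\<open>learn\<close>).
  Afterwards \<open>s\<close> survives only in the target decoder, and the roll-in policy has
  disappeared.\<close>

lemma expected_error_ge:
  assumes k: "k \<ge> 1" and s: "\<bar>s\<bar> \<le> 1"
    and alg: "learning_algorithm n 1 b R act out" and pol: "rollin_policy 1 b Q pol"
  shows "(\<integral>\<^sup>+ r. \<integral>\<^sup>+ D. \<integral>\<^sup>+ y. ennreal (common_density k y) * ennreal ((out r D y - decoder k s y)\<^sup>2)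
      \<partial>lborel \<partial>Pi\<^sub>M {..<n} (\<lambda>_. common_law k) \<partial>R)
    \<le> expected_error (decoder k s) 0 0 0 n 1 1 R act out Q pol"
proof -
  have k0: "k > 0" using k by simp
  let ?f = "decoder k s"
  let ?g = "\<lambda>\<omega>. obs_record (snd \<omega> 0) (inv ?f (fst \<omega> 0) + snd \<omega> 1)"
  interpret Q: prob_space Q using pol by (simp add: rollin_policy_def)
  interpret N: prob_space N01 by (rule prob_space_N01)
  interpret NN: product_prob_space "\<lambda>_::nat. N01" "{..1}" by standard
  interpret PP: pair_prob_space "Pi\<^sub>M {..1::nat} (\<lambda>_. N01)" "Pi\<^sub>M {..1::nat} (\<lambda>_. N01)" ..
  note [measurable] = measurable_inv_decoder[OF k0 s]
  have [measurable]: "?f \<in> borel_measurable borel"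
    by (rule borel_measurable_continuous_onI[OF continuous_on_decoder[OF k0 s]])
  have sn: "sigma_finite_measure (noise 1)"
    unfolding noise_def by unfold_locales
  have sc: "sigma_finite_measure (common_law k)"
    using finite_measure_common_law by (simp add: finite_measure_def)
  have alg_out: "(\<lambda>(r, D, y). out r D y) \<in> borel_measurable (borel \<Otimes>\<^sub>M data_space 1 n \<Otimes>\<^sub>M borel)"
    using alg by (simp add: learning_algorithm_def)
  have gm [measurable]: "?g \<in> measurable (noise 1) (common_law k)"
    unfolding noise_def by measurable
  define L where "L r D = (\<integral>\<^sup>+ y. ennreal (common_density k y) * ennreal ((out r D y - ?f y)\<^sup>2) \<partial>lborel)" for r D
  have outm: "out r D \<in> borel_measurable borel" if "D \<in> space (data_space 1 n)" for r D
  proof -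
    have "(\<lambda>y. (r, D, y)) \<in> measurable borel (borel \<Otimes>\<^sub>M data_space 1 n \<Otimes>\<^sub>M borel)"
      using that by measurable
    from measurable_compose[OF this alg_out] show ?thesis by simp
  qed
  have Lm: "L r \<in> borel_measurable (data_space 1 n)" for r
  proof -
    have [measurable]: "(\<lambda>(D, y). out r D y) \<in> borel_measurable (data_space 1 n \<Otimes>\<^sub>M borel)"
    proof -
      have "(\<lambda>(D, y). (r, D, y)) \<in> measurable (data_space 1 n \<Otimes>\<^sub>M borel) (borel \<Otimes>\<^sub>M data_space 1 n \<Otimes>\<^sub>M borel)"
        by measurable
      from measurable_compose[OF this alg_out] show ?thesis
        by (simp add: split_def)
    qed
    show ?thesis unfolding L_def by measurable
  qed
  have test: "L r D \<le> (\<integral>\<^sup>+ q. \<integral>\<^sup>+ \<xi>.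
      ennreal ((out r D (observations ?f 0 0 0 (pol q) \<xi> 1 1) - ?f (observations ?f 0 0 0 (pol q) \<xi> 1 1))\<^sup>2)
      \<partial>noise 1 \<partial>Q)" if "D \<in> space (data_space 1 n)" for r D
  proof -
    note [measurable] = outm[OF that, of r]
    let ?h = "\<lambda>Y :: obs_seq. ennreal ((out r D (Y 1) - ?f (Y 1))\<^sup>2)"
    have hm: "?h \<in> borel_measurable (Pi\<^sub>M {..1} (\<lambda>_. borel))" by measurable
    have "L r D = (\<integral>\<^sup>+ Y. ?h Y \<partial>common_law k)"
      using N.emeasure_space_1 by (subst nn_integral_common_law[OF hm]) (simp add: L_def)
    also have "\<dots> \<le> (\<integral>\<^sup>+ \<xi>. ?h (?g \<xi>) \<partial>noise 1)"
      by (rule nn_integral_records_ge[OF k s hm])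
    also have "\<dots> = (\<integral>\<^sup>+ q. \<integral>\<^sup>+ \<xi>. ?h (?g \<xi>) \<partial>noise 1 \<partial>Q)"
      by (simp add: Q.emeasure_space_1)
    finally show ?thesis
      unfolding observations_uncontrolled inv_decoder_0[OF k0 s] by simp
  qed
  have "(\<integral>\<^sup>+ D. L r D \<partial>Pi\<^sub>M {..<n} (\<lambda>_. common_law k))
      \<le> (\<integral>\<^sup>+ \<omega>. L r (\<lambda>i\<in>{..<n}. ?g (\<omega> i)) \<partial>Pi\<^sub>M {..<n} (\<lambda>_. noise 1))" for r
  proof (rule nn_integral_PiM_pushforward_ge[OF sn sc _ gm])
    show "L r \<in> borel_measurable (Pi\<^sub>M {..<n} (\<lambda>_. common_law k))"
      using Lm[of r] unfolding data_space_def
      by (simp cong: measurable_cong_sets sets_PiM_cong)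
    show "(\<integral>\<^sup>+ Y. h Y \<partial>common_law k) \<le> (\<integral>\<^sup>+ \<omega>. h (?g \<omega>) \<partial>noise 1)"
      if "h \<in> borel_measurable (common_law k)" for h
      using that by (intro nn_integral_records_ge k s) (simp cong: measurable_cong_sets)
  qed simp
  also have "\<And>r. (\<integral>\<^sup>+ \<omega>. L r (\<lambda>i\<in>{..<n}. ?g (\<omega> i)) \<partial>Pi\<^sub>M {..<n} (\<lambda>_. noise 1)) =
     (\<integral>\<^sup>+ \<omega>. L r (collected_data ?f 0 0 0 1 (act r) \<omega> n) \<partial>Pi\<^sub>M {..<n} (\<lambda>_. noise 1))"
    unfolding collected_data_uncontrolled inv_decoder_0[OF k0 s] by simp
  finally have learn: "(\<integral>\<^sup>+ D. L r D \<partial>Pi\<^sub>M {..<n} (\<lambda>_. common_law k))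
    \<le> (\<integral>\<^sup>+ \<omega>. L r (collected_data ?f 0 0 0 1 (act r) \<omega> n) \<partial>Pi\<^sub>M {..<n} (\<lambda>_. noise 1))" for r .
  \<comment> \<open>The learned decoder is known to be measurable only for data in the data space,
    so \<open>test\<close> needs this membership.\<close>
  have D: "collected_data ?f 0 0 0 1 (act r) \<omega> n \<in> space (data_space 1 n)" for r \<omega>
  proof -
    have "obs_record u v \<in> space (Pi\<^sub>M {..1} (\<lambda>_. borel))" for u v
      by (auto simp: obs_record_def space_PiM PiE_def extensional_def)
    then show ?thesis
      unfolding collected_data_uncontrolled data_space_def space_PiM[of "{..<n}"] by auto
  qed
  have "(\<integral>\<^sup>+ r. \<integral>\<^sup>+ D. L r D \<partial>Pi\<^sub>M {..<n} (\<lambda>_. common_law k) \<partial>R)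
      \<le> expected_error ?f 0 0 0 n 1 1 R act out Q pol"
    unfolding expected_error_def Let_def
    by (intro nn_integral_mono order_trans[OF learn] nn_integral_mono test D)
  then show ?thesis by (simp add: L_def)
qed

section \<open>The two-point argument\<close>

text \<open>The integral is \<open>1 / 2 - sin (2 * k) / (4 * k)\<close>, so the zeros of the
  oscillation cost at most a constant factor.\<close>

lemma nn_integral_sin_squared_ge:
  assumes k: "k \<ge> (1::real)"
  shows "ennreal (1 / 4) \<le> (\<integral>\<^sup>+ y. ennreal ((sin (k * y))\<^sup>2) * indicator {0..1} y \<partial>lborel)"
proof -
  have "(\<integral>\<^sup>+ y. ennreal ((sin (k * y))\<^sup>2) * indicator {0..1} y \<partial>lborel)
      = ennreal ((1 / 2 - sin (2 * (k * 1)) / (4 * k)) - (0 / 2 - sin (2 * (k * 0)) / (4 * k)))"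
  proof (rule nn_integral_FTC_Icc[where F="\<lambda>y. y / 2 - sin (2 * (k * y)) / (4 * k)"])
    fix y :: real
    have "((\<lambda>y. y / 2 - sin (2 * (k * y)) / (4 * k)) has_real_derivative 1 / 2 - cos (2 * (k * y)) * (2 * k) / (4 * k)) (at y)"
      using k by (auto intro!: derivative_eq_intros)
    also have "1 / 2 - cos (2 * (k * y)) * (2 * k) / (4 * k) = (sin (k * y))\<^sup>2"
      unfolding cos_double_sin using k by (simp add: field_simps)
    finally show "((\<lambda>y. y / 2 - sin (2 * (k * y)) / (4 * k)) has_real_derivative (sin (k * y))\<^sup>2) (at y)" .
  qed auto
  moreover have "sin (2 * k) / (4 * k) \<le> 1 / 4"
    using k sin_le_one[of "2 * k"] by (subst pos_divide_le_eq) (simp, linarith)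
  ultimately show ?thesis by (simp add: ennreal_leI)
qed

text \<open>A single estimate \<open>g\<close> cannot be close to two separated targets: with
  \<open>?a\<close> and \<open>?b\<close> the two errors, the squared gap is at most
  \<open>2 * (?a\<^sup>2 + ?b\<^sup>2)\<close>. Integrating over [0, 1], where the common density is
  at least 1/10, gives the bound.\<close>

lemma decoder_separation:
  fixes g :: "real \<Rightarrow> real"
  assumes k: "k \<ge> 1" and [measurable]: "g \<in> borel_measurable borel"
  shows "ennreal (exp (- 9) / 5120 / k\<^sup>2)
    \<le> (\<integral>\<^sup>+ y. ennreal (common_density k y) * ennreal ((g y - decoder k 1 y)\<^sup>2) \<partial>lborel)
    + (\<integral>\<^sup>+ y. ennreal (common_density k y) * ennreal ((g y - decoder k (-1) y)\<^sup>2) \<partial>lborel)"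
proof -
  have k0: "k > 0" using k by simp
  have [measurable]: "decoder k 1 \<in> borel_measurable borel" "decoder k (-1) \<in> borel_measurable borel"
    by (intro borel_measurable_continuous_onI continuous_on_decoder; use k0 in simp)+
  \<comment> \<open>The squared gap from \<open>decoder_diff_ge\<close> has constant
    \<open>exp (- 9) / 64\<close>; division by 20 accounts for the factor 2 and the density bound
    1/10. The mean 1/4 of the squared sine later turns 1280 into 5120.\<close>
  define c where "c = exp (- 9) / 1280 / k\<^sup>2"
  have c: "c \<ge> 0" by (simp add: c_def)
  have pt: "ennreal c * (ennreal ((sin (k * y))\<^sup>2) * indicator {0..1} y)
      \<le> ennreal (common_density k y) * ennreal ((g y - decoder k 1 y)\<^sup>2)
       + ennreal (common_density k y) * ennreal ((g y - decoder k (-1) y)\<^sup>2)" for y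
  proof (cases "y \<in> {0..1}")
    case True
    then have y: "0 \<le> y" "y \<le> 1" by auto
    let ?a = "g y - decoder k 1 y" and ?b = "g y - decoder k (-1) y"
    have "(exp (- 9 / 2) * \<bar>sin (k * y)\<bar> / (8 * k))\<^sup>2 \<le> \<bar>decoder k 1 y - decoder k (-1) y\<bar>\<^sup>2"
      using k0 by (intro power_mono decoder_diff_ge y) auto
    also have "(exp (- 9 / 2) * \<bar>sin (k * y)\<bar> / (8 * k))\<^sup>2 = 20 * (c * (sin (k * y))\<^sup>2)"
      by (simp add: c_def power_mult_distrib power_divide exp_double[symmetric])
    also have "\<bar>decoder k 1 y - decoder k (-1) y\<bar>\<^sup>2 = (?b - ?a)\<^sup>2" by (simp add: power2_abs)
    also have "\<dots> \<le> 2 * (?a\<^sup>2 + ?b\<^sup>2)"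
      using zero_le_power2[of "?a + ?b"] by (simp add: power2_eq_square algebra_simps)
    finally have "c * (sin (k * y))\<^sup>2 \<le> 1 / 10 * (?a\<^sup>2 + ?b\<^sup>2)" by simp
    also have "\<dots> \<le> common_density k y * (?a\<^sup>2 + ?b\<^sup>2)"
      by (intro mult_right_mono common_density_ge y) auto
    finally have "ennreal (c * (sin (k * y))\<^sup>2) \<le> ennreal (common_density k y * ?a\<^sup>2 + common_density k y * ?b\<^sup>2)"
      by (intro ennreal_leI) (simp add: algebra_simps)
    moreover have "0 \<le> common_density k y" using common_density_ge[OF y, of k] by simp
    ultimately show ?thesis
      using True c by (simp add: ennreal_mult ennreal_plus)
  qed simp
  have "ennreal (exp (- 9) / 5120 / k\<^sup>2) = ennreal c * ennreal (1 / 4)"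
    using c by (subst ennreal_mult[symmetric]) (simp_all add: c_def)
  also have "\<dots> \<le> ennreal c * (\<integral>\<^sup>+ y. ennreal ((sin (k * y))\<^sup>2) * indicator {0..1} y \<partial>lborel)"
    by (intro mult_left_mono nn_integral_sin_squared_ge k) simp
  also have "\<dots> = (\<integral>\<^sup>+ y. ennreal c * (ennreal ((sin (k * y))\<^sup>2) * indicator {0..1} y) \<partial>lborel)"
    by (rule nn_integral_cmult[symmetric]) measurable
  also have "\<dots> \<le> (\<integral>\<^sup>+ y. ennreal (common_density k y) * ennreal ((g y - decoder k 1 y)\<^sup>2)
       + ennreal (common_density k y) * ennreal ((g y - decoder k (-1) y)\<^sup>2) \<partial>lborel)"
    by (intro nn_integral_mono pt)
  also have "\<dots> = (\<integral>\<^sup>+ y. ennreal (common_density k y) * ennreal ((g y - decoder k 1 y)\<^sup>2) \<partial>lborel)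
    + (\<integral>\<^sup>+ y. ennreal (common_density k y) * ennreal ((g y - decoder k (-1) y)\<^sup>2) \<partial>lborel)"
    by (rule nn_integral_add) measurable
  finally show ?thesis .
qed

text \<open>Each record loses mass at most \<open>1 / (16 n)\<close> under the hypothesis, so by the
  Bernoulli inequality \<open>n\<close> records lose at most 1/16 in total.\<close>

lemma emeasure_common_law_power_ge:
  assumes "exp (- (k\<^sup>2 / 20)) * real n \<le> 1"
  shows "ennreal (15 / 16) \<le> emeasure (Pi\<^sub>M {..<n} (\<lambda>_. common_law k)) (space (Pi\<^sub>M {..<n} (\<lambda>_. common_law k)))"
proof -
  interpret F: finite_measure "common_law k" by (rule finite_measure_common_law)
  interpret product_sigma_finite "\<lambda>_::nat. common_law k" by standard
  define x where "x = exp (- (k\<^sup>2 / 20)) / 16"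
  have x: "0 \<le> x" "x \<le> 1" by (auto simp: x_def intro: order_trans[of _ 1])
  have "15 / 16 \<le> 1 + real n * - x" using assms by (simp add: x_def mult.commute)
  also have "\<dots> \<le> (1 + - x) ^ n"
    using x by (intro Bernoulli_inequality) auto
  finally have "ennreal (15 / 16) \<le> ennreal (1 - x) ^ n"
    using x by (simp add: ennreal_power ennreal_leI)
  also have "\<dots> \<le> emeasure (common_law k) (space (common_law k)) ^ n"
    unfolding x_def by (intro power_mono emeasure_common_law_ge) simp
  also have "\<dots> = emeasure (Pi\<^sub>M {..<n} (\<lambda>_. common_law k)) (space (Pi\<^sub>M {..<n} (\<lambda>_. common_law k)))"
    unfolding space_PiM using sets.top[of "common_law k"] by (subst emeasure_PiM) auto
  finally show ?thesis .
qed

text \<open>Both lower bounds of \<open>expected_error_ge\<close> integrate over the same data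
  measure, so they can be added under the integral. For each seed and data set
  \<open>decoder_separation\<close> then applies to the one decoder that is output.\<close>

lemma expected_error_sum_ge:
  assumes k: "k \<ge> 1" and n: "exp (- (k\<^sup>2 / 20)) * real n \<le> 1"
    and alg: "learning_algorithm n 1 b R act out" and pol: "rollin_policy 1 b Q pol"
  shows "ennreal (15 / 16 * (exp (- 9) / 5120 / k\<^sup>2))
    \<le> expected_error (decoder k 1) 0 0 0 n 1 1 R act out Q pol
     + expected_error (decoder k (-1)) 0 0 0 n 1 1 R act out Q pol"
proof -
  let ?P = "Pi\<^sub>M {..<n} (\<lambda>_. common_law k)"
  let ?c = "exp (- 9) / 5120 / k\<^sup>2"
  let ?L = "\<lambda>s r D. \<integral>\<^sup>+ y. ennreal (common_density k y) * ennreal ((out r D y - decoder k s y)\<^sup>2) \<partial>lborel"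
  interpret R: prob_space R using alg by (simp add: learning_algorithm_def)
  have [measurable_cong]: "sets R = sets borel" using alg by (simp add: learning_algorithm_def)
  interpret F: finite_measure "common_law k" by (rule finite_measure_common_law)
  interpret product_sigma_finite "\<lambda>_::nat. common_law k" by standard
  interpret P: sigma_finite_measure ?P by (rule sigma_finite) simp
  have k0: "k > 0" using k by simp
  have sets_eq: "sets ?P = sets (data_space 1 n)"
    unfolding data_space_def by (rule sets_PiM_cong) auto
  note [measurable_cong] = sets_eq
  have [measurable]: "decoder k 1 \<in> borel_measurable borel" "decoder k (-1) \<in> borel_measurable borel"
    by (intro borel_measurable_continuous_onI continuous_on_decoder; use k0 in simp)+
  have alg_out: "(\<lambda>(r, D, y). out r D y) \<in> borel_measurable (borel \<Otimes>\<^sub>M data_space 1 n \<Otimes>\<^sub>M borel)"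
    using alg by (simp add: learning_algorithm_def)
  have [measurable]: "(\<lambda>p. out (fst (fst p)) (snd (fst p)) (snd p)) \<in> borel_measurable ((R \<Otimes>\<^sub>M ?P) \<Otimes>\<^sub>M borel)"
  proof -
    have "(\<lambda>p. (fst (fst p), snd (fst p), snd p)) \<in> measurable ((R \<Otimes>\<^sub>M ?P) \<Otimes>\<^sub>M borel) (borel \<Otimes>\<^sub>M data_space 1 n \<Otimes>\<^sub>M borel)"
      by measurable
    from measurable_compose[OF this alg_out] show ?thesis by simp
  qed
  have Lm: "(\<lambda>(r, D). ?L s r D) \<in> borel_measurable (R \<Otimes>\<^sub>M ?P)" if "s \<in> {1, -1}" for s
    using that unfolding split_def by (auto intro!: lborel.borel_measurable_nn_integral simp: split_def)
  have Lm1 [measurable]: "(\<lambda>D. ?L s r D) \<in> borel_measurable ?P" if "s \<in> {1, -1}" "r \<in> space R" for s r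
    using measurable_Pair2[OF Lm[OF that(1)] that(2)] by simp
  have outm: "out r D \<in> borel_measurable borel" if "D \<in> space ?P" "r \<in> space R" for r D
  proof -
    have "(\<lambda>y. ((r, D), y)) \<in> measurable borel ((R \<Otimes>\<^sub>M ?P) \<Otimes>\<^sub>M borel)"
      using that by measurable
    from measurable_compose[OF this, of "\<lambda>p. out (fst (fst p)) (snd (fst p)) (snd p)" borel] show ?thesis by simp
  qed
  have "ennreal (15 / 16 * ?c) = ennreal ?c * ennreal (15 / 16)"
    by (subst ennreal_mult[symmetric]) (simp_all add: mult.commute)
  also have "\<dots> \<le> ennreal ?c * emeasure ?P (space ?P)"
    by (intro mult_left_mono emeasure_common_law_power_ge n) simp
  also have "\<dots> = (\<integral>\<^sup>+ r. \<integral>\<^sup>+ D. ennreal ?c \<partial>?P \<partial>R)"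
    by (simp add: R.emeasure_space_1)
  also have "\<dots> \<le> (\<integral>\<^sup>+ r. \<integral>\<^sup>+ D. ?L 1 r D + ?L (-1) r D \<partial>?P \<partial>R)"
    by (intro nn_integral_mono decoder_separation k outm)
  also have "\<dots> = (\<integral>\<^sup>+ r. (\<integral>\<^sup>+ D. ?L 1 r D \<partial>?P) + (\<integral>\<^sup>+ D. ?L (-1) r D \<partial>?P) \<partial>R)"
    by (intro nn_integral_cong nn_integral_add Lm1) auto
  also have "\<dots> = (\<integral>\<^sup>+ r. \<integral>\<^sup>+ D. ?L 1 r D \<partial>?P \<partial>R) + (\<integral>\<^sup>+ r. \<integral>\<^sup>+ D. ?L (-1) r D \<partial>?P \<partial>R)"
    by (intro nn_integral_add P.borel_measurable_nn_integral Lm) auto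
  also have "\<dots> \<le> expected_error (decoder k 1) 0 0 0 n 1 1 R act out Q pol
     + expected_error (decoder k (-1)) 0 0 0 n 1 1 R act out Q pol"
    by (intro add_mono expected_error_ge[OF k _ alg pol]) auto
  finally show ?thesis .
qed

section \<open>The two-element class and the choice of constants\<close>

lemma decoder_neq:
  assumes "k > 0"
  shows "decoder k 1 \<noteq> decoder k (-1)"
proof
  assume "decoder k 1 = decoder k (-1)"
  \<comment> \<open>At this point the sine equals 1, so the perturbation cannot vanish.\<close>
  then have "2 * bump k (pi / (2 * k)) = 0"
    using Phi_decoder[OF assms, of 1 "pi / (2 * k)"] Phi_decoder[OF assms, of "-1" "pi / (2 * k)"] by simp
  moreover have "k * (pi / (2 * k)) = pi / 2" using assms by simp
  ultimately show False
    using assms phi_pos[of "3 * (pi / (2 * k))"] by (simp add: bump_def)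
qed

theorem theoremA1:
  "\<exists>(n0::nat) (c::real) (C::real). c > 0 \<and> C > 0 \<and>
     (\<forall>n\<ge>n0. \<exists>(F :: (real \<Rightarrow> real) set) (A::real) (B::real) (x0::real).
        card F = 2 \<and>
        (\<forall>f\<in>F. bij f \<and> (C * sqrt (ln (real n)))-lipschitz_on UNIV f \<and>
           (\<forall>y. f differentiable (at y) \<and> deriv f y \<ge> 1)) \<and>
        (\<forall>R act out Q pol.
           learning_algorithm n 1 (64 * sqrt (ln (real n))) R act out \<and>
           rollin_policy 1 (64 * sqrt (ln (real n))) Q pol \<longrightarrow>
           (\<exists>f\<in>F. expected_error f A B x0 n 1 1 R act out Q pol
                     \<ge> ennreal (c * (1 / ln (real n) powr (3 / 2))))))"
proof -
  \<comment> \<open>The factor 15/32 is half of 15/16, from taking the larger of two errors; the 20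
    comes from \<open>k\<^sup>2 = 20 * ln n\<close>.\<close>
  define c :: real where "c = 15 / 32 * (exp (- 9) / 5120 / 20)"
  have "\<exists>(F :: (real \<Rightarrow> real) set) (A::real) (B::real) (x0::real).
        card F = 2 \<and>
        (\<forall>f\<in>F. bij f \<and> (4 * sqrt (ln (real n)))-lipschitz_on UNIV f \<and>
           (\<forall>y. f differentiable (at y) \<and> deriv f y \<ge> 1)) \<and>
        (\<forall>R act out Q pol.
           learning_algorithm n 1 (64 * sqrt (ln (real n))) R act out \<and>
           rollin_policy 1 (64 * sqrt (ln (real n))) Q pol \<longrightarrow>
           (\<exists>f\<in>F. expected_error f A B x0 n 1 1 R act out Q pol
                     \<ge> ennreal (c * (1 / ln (real n) powr (3 / 2)))))" if "n \<ge> 3" for n :: nat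
  proof -
    have "exp 1 \<le> (3 :: real)" by (rule exp_le)
    also have "3 \<le> real n" using that by simp
    finally have ln1: "ln (real n) \<ge> 1" using that by (subst ln_ge_iff) auto
    \<comment> \<open>This makes the damping \<open>exp (- (k\<^sup>2 / 20))\<close> equal to
      \<open>1 / n\<close>, with the slowest oscillation, and hence the largest separation, that
      does so.\<close>
    define k where "k = sqrt (20 * ln (real n))"
    have k2: "k\<^sup>2 = 20 * ln (real n)" using ln1 by (simp add: k_def)
    have k: "k \<ge> 1" unfolding k_def using ln1 by (intro real_le_rsqrt) auto
    have k0: "k > 0" using k by simp
    have n: "exp (- (k\<^sup>2 / 20)) * real n \<le> 1"
      using that by (simp add: k2 exp_minus)
    \<comment> \<open>As \<open>ln n\<close> is at least 1 for \<open>n \<ge> 3\<close>, the rate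
      \<open>1 / ln n\<close> obtained implies the claimed one.\<close>
    have "ln (real n) powr 1 \<le> ln (real n) powr (3 / 2)"
      using ln1 by (intro powr_mono) auto
    then have "c * (1 / ln (real n) powr (3 / 2)) \<le> c * (1 / ln (real n))"
      using ln1 by (intro mult_left_mono divide_left_mono) (auto simp: c_def)
    also have "\<dots> = (15 / 16 * (exp (- 9) / 5120 / k\<^sup>2)) / 2"
      by (simp add: c_def k2)
    finally have rate: "c * (1 / ln (real n) powr (3 / 2)) \<le> (15 / 16 * (exp (- 9) / 5120 / k\<^sup>2)) / 2" .
    have half: "ennreal (x / 2) \<le> a \<or> ennreal (x / 2) \<le> b" if "ennreal x \<le> a + b" "x \<ge> 0" for x a b
    proof (rule ccontr)
      assume "\<not> ?thesis"
      then have "a + b < ennreal (x / 2) + ennreal (x / 2)"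
        by (intro add_strict_mono) auto
      also have "\<dots> = ennreal x" using that by (simp add: ennreal_plus[symmetric])
      finally show False using that by simp
    qed
    let ?F = "{decoder k 1, decoder k (-1)}"
    \<comment> \<open>The class is fixed beforehand; only which of its two members is the hard one
      depends on the algorithm and the policy.\<close>
    have "\<exists>f\<in>?F. expected_error f 0 0 0 n 1 1 R act out Q pol \<ge> ennreal (c * (1 / ln (real n) powr (3 / 2)))"
      if "learning_algorithm n 1 (64 * sqrt (ln (real n))) R act out"
        "rollin_policy 1 (64 * sqrt (ln (real n))) Q pol" for R act out Q pol
      using half[OF expected_error_sum_ge[OF k n that]] order_trans[OF ennreal_leI[OF rate]] by auto
    moreover have "bij f \<and> (4 * sqrt (ln (real n)))-lipschitz_on UNIV f \<and>
           (\<forall>y. f differentiable (at y) \<and> deriv f y \<ge> 1)" if "f \<in> ?F" for f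
    proof -
      from that obtain s where f: "f = decoder k s" and s: "\<bar>s\<bar> \<le> 1" by auto
      \<comment> \<open>The decoders are Lipschitz with the absolute constant 4, and
        \<open>sqrt (ln n)\<close> is at least 1.\<close>
      have "(4 * sqrt (ln (real n)))-lipschitz_on UNIV (decoder k s)"
        using ln1 by (intro lipschitz_on_mono[OF lipschitz_decoder[OF k0 s]]) auto
      then show ?thesis
        unfolding f using bij_decoder[OF k0 s] decoder_differentiable[OF k0 s] deriv_decoder_bounds(1)[OF k0 s] by blast
    qed
    moreover have "card ?F = 2" using decoder_neq[OF k0] by simp
    ultimately show ?thesis by (intro exI[of _ ?F] exI[of _ 0] conjI) blast+
  qed
  moreover have "c > 0" by (simp add: c_def)
  ultimately show ?thesis by (intro exI[of _ 3] exI[of _ c] exI[of _ 4]) auto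
qed

end
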